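(* Let $\nu_j>0$, $j=1,\dots,J$, and $\nu_{max}=\max_{1\le j\le J}\nu_j$, and let $u_R^{j,n}\in X_R$ ($j=1,\dots,J$, $n=0,1,2,\dots$) be generated from initial values $u_R^{j,0}\in X_R$ by the Leray ensemble-POD algorithm: for every $n\ge 0$ and $j=1,\dots,J$, $u_R^{j,n+1}\in X_R$ satisfies $$\Big(\frac{u_{R}^{j,n+1}-u_{R}^{j,n}}{\Delta t},\varphi\Big)+b^{\ast}\big(\overline{\langle u_{R}\rangle^{n}},u_{R}^{j,n+1},\varphi\big)+b^{\ast}\big(\overline{u_{R}^{j,n}-\langle u_{R}\rangle^{n}},u_{R}^{j,n},\varphi\big)+\nu_{max}(\nabla u_{R}^{j,n+1},\nabla\varphi)+(\nu_{j}-\nu_{max})(\nabla u_{R}^{j,n},\nabla\varphi)=(f^{j,n+1},\varphi)\quad\forall\varphi\in X_{R}.$$ Define $0\le\epsilon\le 1$ by $$\max_{1\le j\le J}\frac{|\nu_j-\nu_{max}|}{\nu_{max}}=1-\epsilon,$$ and assume that for $j=1,\dots,J$ and all time levels $n$ under consideration $$\frac{C_{b^*}^2\,\Delta t}{\nu_{max}}\,|||\mathbb{S}_R|||_2^{\frac12}\,\big\|\nabla\big(\overline{u_R^{j,n}-\langle u_R\rangle^n}\big)\big\|^2\le\epsilon .$$ Then for any $N\ge 1$ and each $j=1,\dots,J$, $$\frac12\|u_R^{j,N}\|^2+\frac{\nu_{max}\Delta t}{2}\|\nabla u_R^{j,N}\|^2+\frac{\epsilon\,\nu_{max}\,\Delta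 t}{4}\sum_{n=0}^{N-1}\|\nabla u_R^{j,n+1}\|^2\le\sum_{n=0}^{N-1}\frac{\Delta t}{\nu_{max}\,\epsilon}\|f^{j,n+1}\|_{-1}^2+\frac12\|u_R^{j,0}\|^2+\frac{\nu_{max}\Delta t}{2}\|\nabla u_R^{j,0}\|^2 .$$
   Context: $\Omega\subset\mathbb{R}^d$, $d=2,3$, is an open regular domain; $(\cdot,\cdot)$ and $\|\cdot\|$ are the $L^2(\Omega)$ inner product and norm. $X=[H^1_0(\Omega)]^d$, $Q=L^2_0(\Omega)$, and $\|f\|_{-1}=\sup_{0\ne v\in X}(f,v)/\|\nabla v\|$. $X_h\subset X$, $Q_h\subset Q$ are conforming velocity/pressure finite element spaces satisfying the discrete inf-sup condition, and $V_h=\{v_h\in X_h:(\nabla\cdot v_h,q_h)=0\ \forall q_h\in Q_h\}$. Trilinear form: $b^{\ast}(w,u,v)=\frac12(w\cdot\nabla u,v)-\frac12(w\cdot\nabla v,u)$. $C_{b^*}>0$ is a constant such that for all $u,v,w\in X$: $b^{\ast}(w,u,v)\le C_{b^*}\|\nabla w\|\,\|\nabla u\|\,(\|v\|\,\|\nabla v\|)^{1/2}$ and $b^{\ast}(w,u,v)\le C_{b^*}(\|w\|\,\|\nabla w\|)^{1/2}\|\nabla u\|\,\|\nabla v\|$. POD space: $X_R=\mathrm{span}\{\varphi_i\}_{i=1}^R\subset V_h\subset X_h\subset X$, where $\{\varphi_i\}_{i=1}^R$ is an $L^2(\Omega)$-orthonormal set (the POD basis, minimizing $\sum_{k,l}\|u_{h,S}^{k,l}-\sum_{i=1}^R(u_{h,S}^{k,l},\varphi_i)\varphi_i\|^2$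 over orthonormal sets for a finite family of finite element snapshots $u_{h,S}^{k,l}\in V_h$). $\mathbb{S}_R$ is the $R\times R$ POD stiffness matrix with entries $(\nabla\varphi_i,\nabla\varphi_j)$ and $|||\cdot|||_2$ is the matrix 2-norm; the POD inverse estimate $\|\nabla\varphi\|\le|||\mathbb{S}_R|||_2^{1/2}\|\varphi\|$ holds for all $\varphi\in X_R$. ROM differential filter with filtering radius $\delta>0$: for $v\in X$, $\overline{v}$ is the unique element of $X_R$ with $\delta^2(\nabla\overline v,\nabla\varphi)+(\overline v,\varphi)=(v,\varphi)$ for all $\varphi\in X_R$. $\Delta t>0$ is the time step, $t^n=n\Delta t$, $f^{j,n}=f^j(\cdot,t^n)$ are the values of the given body forces, and $\langle u_R\rangle^n=\frac1J\sum_{j=1}^J u_R^{j,n}$ is the ensemble mean. (Since all viscosities $\nu_j$ are positive, $\epsilon>0$.) *)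

theory Defs
  imports "HOL-Analysis.Analysis"
begin

text \<open>
  Functions on \<open>\<Omega>\<close> are represented by total functions on \<open>real ^ 'n\<close> whose values outside \<open>\<Omega>\<close>
  are irrelevant; elements of \<open>L\<^sup>2(\<Omega>)\<close> are representatives (no quotient by equality almost
  everywhere is formed).
\<close>

section \<open>Domains\<close>

text \<open>
  A regular domain: nonempty, open, connected, with boundary that is locally the graph of a
  Lipschitz function, \<open>\<Omega>\<close> lying on one side of it.  Boundedness is not required; norms that may
  then be infinite are taken in the extended reals.
\<close>

definition lipschitz_boundary :: "(real ^ 'n) set \<Rightarrow> bool" where
  "lipschitz_boundary \<Omega> \<longleftrightarrow>
     (\<forall>x\<in>frontier \<Omega>. \<exists>r>0. \<exists>e. \<exists>K. \<exists>g :: real ^ 'n \<Rightarrow> real.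
        norm e = 1 \<and> K-lipschitz_on UNIV g \<and>
        (\<forall>y\<in>ball x r. y \<in> \<Omega> \<longleftrightarrow> y \<bullet> e < g (y - (y \<bullet> e) *\<^sub>R e)))"

definition regular_domain :: "(real ^ 'n) set \<Rightarrow> bool" where
  "regular_domain \<Omega> \<longleftrightarrow> \<Omega> \<noteq> {} \<and> open \<Omega> \<and> connected \<Omega> \<and> lipschitz_boundary \<Omega>"

section \<open>The space \<open>L\<^sup>2(\<Omega>)\<close>\<close>

definition L2 :: "(real ^ 'n) set \<Rightarrow> (real ^ 'n \<Rightarrow> 'b::euclidean_space) set" where
  "L2 \<Omega> = {f \<in> borel_measurable (lebesgue_on \<Omega>).
             integrable (lebesgue_on \<Omega>) (\<lambda>x. (norm (f x))\<^sup>2)}"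

definition L2_inner ::
  "(real ^ 'n) set \<Rightarrow> (real ^ 'n \<Rightarrow> 'b::euclidean_space) \<Rightarrow> (real ^ 'n \<Rightarrow> 'b) \<Rightarrow> real" where
  "L2_inner \<Omega> u v = integral\<^sup>L (lebesgue_on \<Omega>) (\<lambda>x. u x \<bullet> v x)"

definition L2_norm :: "(real ^ 'n) set \<Rightarrow> (real ^ 'n \<Rightarrow> 'b::euclidean_space) \<Rightarrow> real" where
  "L2_norm \<Omega> u = sqrt (L2_inner \<Omega> u u)"

definition ae_zero :: "(real ^ 'n) set \<Rightarrow> (real ^ 'n \<Rightarrow> 'b::euclidean_space) \<Rightarrow> bool" where
  "ae_zero \<Omega> u \<longleftrightarrow> (AE x in lebesgue_on \<Omega>. u x = 0)"

definition L2_mean_zero :: "(real ^ 'n) set \<Rightarrow> (real ^ 'n \<Rightarrow> real) set" where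
  "L2_mean_zero \<Omega> = {q \<in> L2 \<Omega>. has_bochner_integral (lebesgue_on \<Omega>) q 0}"

section \<open>Test functions, weak gradients and \<open>H\<^sup>1\<^sub>0(\<Omega>)\<close>\<close>

definition partial_deriv :: "'n \<Rightarrow> (real ^ 'n \<Rightarrow> real) \<Rightarrow> real ^ 'n \<Rightarrow> real" where
  "partial_deriv i f x = frechet_derivative f (at x) (axis i 1)"

fun Ck :: "nat \<Rightarrow> (real ^ 'n \<Rightarrow> real) \<Rightarrow> bool" where
  "Ck 0 f \<longleftrightarrow> continuous_on UNIV f"
| "Ck (Suc k) f \<longleftrightarrow> f differentiable_on UNIV \<and> (\<forall>i. Ck k (partial_deriv i f))"

definition test_function :: "(real ^ 'n) set \<Rightarrow> (real ^ 'n \<Rightarrow> real) \<Rightarrow> bool" where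
  "test_function \<Omega> \<psi> \<longleftrightarrow> (\<forall>k. Ck k \<psi>) \<and>
     compact (closure {x. \<psi> x \<noteq> 0}) \<and> closure {x. \<psi> x \<noteq> 0} \<subseteq> \<Omega>"

definition is_weak_gradient ::
  "(real ^ 'n) set \<Rightarrow> (real ^ 'n \<Rightarrow> real) \<Rightarrow> (real ^ 'n \<Rightarrow> real ^ 'n) \<Rightarrow> bool" where
  "is_weak_gradient \<Omega> v g \<longleftrightarrow> g \<in> L2 \<Omega> \<and>
     (\<forall>\<psi>. test_function \<Omega> \<psi> \<longrightarrow>
        (\<forall>i. integral\<^sup>L (lebesgue_on \<Omega>) (\<lambda>x. v x * partial_deriv i \<psi> x) =
             - integral\<^sup>L (lebesgue_on \<Omega>) (\<lambda>x. g x $ i * \<psi> x)))"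

text \<open>The weak gradient is determined only up to a null set; one representative is chosen.\<close>

definition weak_gradient ::
  "(real ^ 'n) set \<Rightarrow> (real ^ 'n \<Rightarrow> real) \<Rightarrow> real ^ 'n \<Rightarrow> real ^ 'n" where
  "weak_gradient \<Omega> v = (SOME g. is_weak_gradient \<Omega> v g)"

definition H1 :: "(real ^ 'n) set \<Rightarrow> (real ^ 'n \<Rightarrow> real) set" where
  "H1 \<Omega> = {v \<in> L2 \<Omega>. \<exists>g. is_weak_gradient \<Omega> v g}"

definition H1_norm :: "(real ^ 'n) set \<Rightarrow> (real ^ 'n \<Rightarrow> real) \<Rightarrow> real" where
  "H1_norm \<Omega> v = sqrt ((L2_norm \<Omega> v)\<^sup>2 + (L2_norm \<Omega> (weak_gradient \<Omega> v))\<^sup>2)"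

definition H10 :: "(real ^ 'n) set \<Rightarrow> (real ^ 'n \<Rightarrow> real) set" where
  "H10 \<Omega> = {v \<in> H1 \<Omega>. \<exists>\<psi>. (\<forall>k::nat. test_function \<Omega> (\<psi> k)) \<and>
              (\<lambda>k. H1_norm \<Omega> (\<lambda>x. \<psi> k x - v x)) \<longlonglongrightarrow> 0}"

section \<open>Velocity fields\<close>

definition velocity_space :: "(real ^ 'n) set \<Rightarrow> (real ^ 'n \<Rightarrow> real ^ 'n) set" where
  "velocity_space \<Omega> = {v. \<forall>i. (\<lambda>x. v x $ i) \<in> H10 \<Omega>}"

text \<open>Entry \<open>(i, j)\<close> of \<open>grad \<Omega> v x\<close> is \<open>\<partial>\<^sub>j v\<^sub>i(x)\<close>; the inner product on matrices is the
  Frobenius one.\<close>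

definition grad ::
  "(real ^ 'n) set \<Rightarrow> (real ^ 'n \<Rightarrow> real ^ 'n) \<Rightarrow> real ^ 'n \<Rightarrow> real ^ 'n ^ 'n" where
  "grad \<Omega> v x = (\<chi> i. weak_gradient \<Omega> (\<lambda>y. v y $ i) x)"

definition divergence ::
  "(real ^ 'n) set \<Rightarrow> (real ^ 'n \<Rightarrow> real ^ 'n) \<Rightarrow> real ^ 'n \<Rightarrow> real" where
  "divergence \<Omega> v x = trace (grad \<Omega> v x)"

text \<open>
  The supremum is taken in the extended reals, so that no boundedness of the set of quotients
  (Poincare inequality) has to be presupposed.
\<close>

definition dual_norm :: "(real ^ 'n) set \<Rightarrow> (real ^ 'n \<Rightarrow> real ^ 'n) \<Rightarrow> ereal" where
  "dual_norm \<Omega> f =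
     (SUP v\<in>{v \<in> velocity_space \<Omega>. \<not> ae_zero \<Omega> v}.
        ereal (L2_inner \<Omega> f v) / ereal (L2_norm \<Omega> (grad \<Omega> v)))"

definition bstar ::
  "(real ^ 'n) set \<Rightarrow> (real ^ 'n \<Rightarrow> real ^ 'n) \<Rightarrow> (real ^ 'n \<Rightarrow> real ^ 'n) \<Rightarrow>
    (real ^ 'n \<Rightarrow> real ^ 'n) \<Rightarrow> real" where
  "bstar \<Omega> w u v =
     1/2 * L2_inner \<Omega> (\<lambda>x. grad \<Omega> u x *v w x) v - 1/2 * L2_inner \<Omega> (\<lambda>x. grad \<Omega> v x *v w x) u"

definition bstar_constant :: "(real ^ 'n) set \<Rightarrow> real \<Rightarrow> bool" where
  "bstar_constant \<Omega> C \<longleftrightarrow> C > 0 \<and>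
     (\<forall>u\<in>velocity_space \<Omega>. \<forall>v\<in>velocity_space \<Omega>. \<forall>w\<in>velocity_space \<Omega>.
        bstar \<Omega> w u v \<le> C * L2_norm \<Omega> (grad \<Omega> w) * L2_norm \<Omega> (grad \<Omega> u) *
          sqrt (L2_norm \<Omega> v * L2_norm \<Omega> (grad \<Omega> v)) \<and>
        bstar \<Omega> w u v \<le> C * sqrt (L2_norm \<Omega> w * L2_norm \<Omega> (grad \<Omega> w)) *
          L2_norm \<Omega> (grad \<Omega> u) * L2_norm \<Omega> (grad \<Omega> v))"

section \<open>Finite element spaces\<close>

definition fun_span :: "('a \<Rightarrow> 'b::real_vector) set \<Rightarrow> ('a \<Rightarrow> 'b) set" where
  "fun_span B = {u. \<exists>c. u = (\<lambda>x. \<Sum>b\<in>B. c b *\<^sub>R b x)}"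

definition finite_dim_space :: "('a \<Rightarrow> 'b::real_vector) set \<Rightarrow> bool" where
  "finite_dim_space U \<longleftrightarrow> (\<exists>B. finite B \<and> U = fun_span B)"

definition inf_sup_condition ::
  "(real ^ 'n) set \<Rightarrow> (real ^ 'n \<Rightarrow> real ^ 'n) set \<Rightarrow> (real ^ 'n \<Rightarrow> real) set \<Rightarrow> bool" where
  "inf_sup_condition \<Omega> Xh Qh \<longleftrightarrow>
     (\<exists>\<beta>>0. ereal \<beta> \<le>
        (INF q\<in>{q \<in> Qh. \<not> ae_zero \<Omega> q}. SUP v\<in>{v \<in> Xh. \<not> ae_zero \<Omega> v}.
           ereal (L2_inner \<Omega> (divergence \<Omega> v) q / (L2_norm \<Omega> (grad \<Omega> v) * L2_norm \<Omega> q))))"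

text \<open>Finite element spaces enter only as conforming finite-dimensional linear spaces.\<close>

definition conforming_fe_pair ::
  "(real ^ 'n) set \<Rightarrow> (real ^ 'n \<Rightarrow> real ^ 'n) set \<Rightarrow> (real ^ 'n \<Rightarrow> real) set \<Rightarrow> bool" where
  "conforming_fe_pair \<Omega> Xh Qh \<longleftrightarrow>
     finite_dim_space Xh \<and> Xh \<subseteq> velocity_space \<Omega> \<and>
     finite_dim_space Qh \<and> Qh \<subseteq> L2_mean_zero \<Omega> \<and>
     inf_sup_condition \<Omega> Xh Qh"

definition discretely_div_free ::
  "(real ^ 'n) set \<Rightarrow> (real ^ 'n \<Rightarrow> real ^ 'n) set \<Rightarrow> (real ^ 'n \<Rightarrow> real) set \<Rightarrow>
    (real ^ 'n \<Rightarrow> real ^ 'n) set" where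
  "discretely_div_free \<Omega> Xh Qh = {v \<in> Xh. \<forall>q\<in>Qh. L2_inner \<Omega> (divergence \<Omega> v) q = 0}"

section \<open>Proper orthogonal decomposition\<close>

text \<open>The index type \<open>'r\<close> stands for \<open>{1, \<dots>, R}\<close>, that is, \<open>R = CARD('r)\<close>.\<close>

definition L2_orthonormal ::
  "(real ^ 'n) set \<Rightarrow> ('r::finite \<Rightarrow> real ^ 'n \<Rightarrow> real ^ 'n) \<Rightarrow> bool" where
  "L2_orthonormal \<Omega> \<phi> \<longleftrightarrow> (\<forall>i. \<phi> i \<in> L2 \<Omega>) \<and>
     (\<forall>i j. L2_inner \<Omega> (\<phi> i) (\<phi> j) = (if i = j then 1 else 0))"

definition pod_error ::
  "(real ^ 'n) set \<Rightarrow> (nat \<times> nat) set \<Rightarrow> (nat \<Rightarrow> nat \<Rightarrow> real ^ 'n \<Rightarrow> real ^ 'n) \<Rightarrow>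
    ('r::finite \<Rightarrow> real ^ 'n \<Rightarrow> real ^ 'n) \<Rightarrow> real" where
  "pod_error \<Omega> I s \<phi> =
     (\<Sum>(k, l)\<in>I. (L2_norm \<Omega> (\<lambda>x. s k l x - (\<Sum>i\<in>UNIV. L2_inner \<Omega> (s k l) (\<phi> i) *\<^sub>R \<phi> i x)))\<^sup>2)"

definition pod_basis ::
  "(real ^ 'n) set \<Rightarrow> (nat \<times> nat) set \<Rightarrow> (nat \<Rightarrow> nat \<Rightarrow> real ^ 'n \<Rightarrow> real ^ 'n) \<Rightarrow>
    ('r::finite \<Rightarrow> real ^ 'n \<Rightarrow> real ^ 'n) \<Rightarrow> bool" where
  "pod_basis \<Omega> I s \<phi> \<longleftrightarrow> L2_orthonormal \<Omega> \<phi> \<and>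
     (\<forall>\<psi> :: 'r \<Rightarrow> real ^ 'n \<Rightarrow> real ^ 'n.
        L2_orthonormal \<Omega> \<psi> \<longrightarrow> pod_error \<Omega> I s \<phi> \<le> pod_error \<Omega> I s \<psi>)"

definition pod_space ::
  "('r::finite \<Rightarrow> real ^ 'n \<Rightarrow> real ^ 'n) \<Rightarrow> (real ^ 'n \<Rightarrow> real ^ 'n) set" where
  "pod_space \<phi> = fun_span (range \<phi>)"

definition pod_stiffness ::
  "(real ^ 'n) set \<Rightarrow> ('r::finite \<Rightarrow> real ^ 'n \<Rightarrow> real ^ 'n) \<Rightarrow> real ^ 'r ^ 'r" where
  "pod_stiffness \<Omega> \<phi> = (\<chi> i j. L2_inner \<Omega> (grad \<Omega> (\<phi> i)) (grad \<Omega> (\<phi> j)))"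

definition matrix_norm2 :: "real ^ 'r ^ 'r \<Rightarrow> real" where
  "matrix_norm2 A = onorm (\<lambda>x. A *v x)"

definition rom_filter ::
  "(real ^ 'n) set \<Rightarrow> real \<Rightarrow> (real ^ 'n \<Rightarrow> real ^ 'n) set \<Rightarrow> (real ^ 'n \<Rightarrow> real ^ 'n) \<Rightarrow>
    real ^ 'n \<Rightarrow> real ^ 'n" where
  "rom_filter \<Omega> \<delta> XR v =
     (THE w. w \<in> XR \<and>
        (\<forall>\<phi>\<in>XR. \<delta>\<^sup>2 * L2_inner \<Omega> (grad \<Omega> w) (grad \<Omega> \<phi>) + L2_inner \<Omega> w \<phi> = L2_inner \<Omega> v \<phi>))"

definition ensemble_mean :: "nat \<Rightarrow> (nat \<Rightarrow> 'a \<Rightarrow> 'b::real_vector) \<Rightarrow> 'a \<Rightarrow> 'b" where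
  "ensemble_mean J u x = (1 / real J) *\<^sub>R (\<Sum>j=1..J. u j x)"

end

(*
  Testing the scheme with u^{n+1} gives the usual energy balance; the explicit convection term
  b*(w, u^n, u^{n+1}) equals b*(w, u^n, u^{n+1} - u^n), which the inverse estimate and the time
  step condition absorb into the numerical dissipation |u^{n+1} - u^n|^2 / 2.  Additivity of b* in
  its last argument requires the products (grad u w) . v to be integrable, since the Bochner
  integral is 0 otherwise.  This is where d = 2, 3 enters: Ladyzhenskaya's inequality for test
  functions, together with Fatou's lemma, embeds H^1_0 into L^4.  Linearity of the weak gradient
  rests on its uniqueness, i.e. on the fundamental lemma of the calculus of variations.
*)
theory Submission
  imports Defs
begin

text \<open>\<open>\<Omega>\<close> may be unbounded, so no Poincare inequality is at hand. The
  embedding into L^4 therefore uses the full H^1 norm, and the dual norm of the force may be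
  infinite, which is why the final estimate lives in \<open>ereal\<close>. The budget of one time
  step is exact. Let G and G' be the old and new gradient norms and D the L^2 norm of the increment.
  The explicit viscous term costs (1 - \<epsilon>) \<nu>max dt (G^2 + G'^2) / 2. The convection term
  is bounded by D^2 / 2, which uses up all the numerical dissipation, plus \<epsilon> \<nu>max dt
  G^2 / 2. The total coefficient of G^2 is thus \<nu>max dt / 2, which telescopes. Of the implicit
  term \<nu>max dt G'^2 there remains (1 + \<epsilon>) \<nu>max dt G'^2 / 2. The part without
  \<epsilon> telescopes; the part with \<epsilon> is shared equally: one half stays in the estimate,
  the other pays for the force. Hence the factors \<epsilon> / 4 and 1 / (\<nu>max
  \<epsilon>).\<close>

section \<open>Smooth bump functions\<close>

lemma partial_deriv_eq:
  assumes "(f has_derivative f') (at x)"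
  shows "partial_deriv i f x = f' (axis i 1)"
  unfolding partial_deriv_def using frechet_derivative_at[OF assms] by simp

lemma has_derivative_frechet:
  fixes f :: "real ^ 'n \<Rightarrow> real"
  assumes "f differentiable_on UNIV"
  shows "(f has_derivative frechet_derivative f (at x)) (at x)"
  using assms by (simp add: differentiable_on_def frechet_derivative_works)

lemma Ck_Suc_D: "Ck (Suc k) f \<Longrightarrow> Ck k f"
proof (induction k arbitrary: f)
  case 0
  then show ?case by (simp add: differentiable_imp_continuous_on)
next
  case (Suc k)
  then show ?case by auto
qed

lemma Ck_const: "Ck k (\<lambda>x. c)"
proof (induction k arbitrary: c)
  case (Suc k)
  have "partial_deriv i (\<lambda>x::real^'a. c) = (\<lambda>x. 0)" for i
    by (auto simp: partial_deriv_def)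
  with Suc show ?case by simp
qed simp

lemma partial_deriv_add:
  assumes "f differentiable_on UNIV" "g differentiable_on UNIV"
  shows "partial_deriv i (\<lambda>x. f x + g x) = (\<lambda>x. partial_deriv i f x + partial_deriv i g x)"
  using partial_deriv_eq[OF has_derivative_add[OF has_derivative_frechet has_derivative_frechet], OF assms]
  by (auto simp: partial_deriv_def)

lemma partial_deriv_mult:
  assumes "f differentiable_on UNIV" "g differentiable_on UNIV"
  shows "partial_deriv i (\<lambda>x. f x * g x) = (\<lambda>x. f x * partial_deriv i g x + partial_deriv i f x * g x)"
  using partial_deriv_eq[OF has_derivative_mult[OF has_derivative_frechet has_derivative_frechet], OF assms]
  by (auto simp: partial_deriv_def)

lemma Ck_add: "Ck k f \<Longrightarrow> Ck k g \<Longrightarrow> Ck k (\<lambda>x. f x + g x)"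
proof (induction k arbitrary: f g)
  case 0
  then show ?case by (auto intro: continuous_on_add)
next
  case (Suc k)
  then show ?case by (auto simp: partial_deriv_add)
qed

lemma Ck_mult: "Ck k f \<Longrightarrow> Ck k g \<Longrightarrow> Ck k (\<lambda>x. f x * g x)"
proof (induction k arbitrary: f g)
  case 0
  then show ?case by (auto intro: continuous_on_mult)
next
  case (Suc k)
  have "Ck k f" "Ck k g" using Suc.prems by (auto intro: Ck_Suc_D)
  with Suc show ?case by (auto simp: partial_deriv_mult intro!: Ck_add)
qed

lemma Ck_prod: "finite A \<Longrightarrow> (\<And>a. a \<in> A \<Longrightarrow> Ck k (f a)) \<Longrightarrow> Ck k (\<lambda>x. \<Prod>a\<in>A. f a x)"
  by (induction A rule: finite_induct) (auto intro: Ck_const Ck_mult)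

text \<open>The functions p(1/t) exp(-c/t), extended by 0, are closed under differentiation, so
  carrying the polynomial \<open>p\<close> along turns smoothness into an induction. The rate
  \<open>c\<close> stays free because the bumps let it tend to 0.\<close>

definition flat_exp :: "real poly \<Rightarrow> real \<Rightarrow> real \<Rightarrow> real" where
  "flat_exp p c t = (if t > 0 then poly p (1 / t) * exp (- (c / t)) else 0)"

text \<open>With s = 1/t this is the decay of p(s) exp(-c s) at infinity, checked monomial by
  monomial.\<close>

lemma flat_exp_lim:
  fixes c :: real
  assumes "c > 0"
  shows "((\<lambda>t. poly p (1 / t) * exp (- (c / t))) \<longlongrightarrow> 0) (at_right 0)"
proof -
  have "((\<lambda>s. \<Sum>i\<le>degree p. coeff p i * (inverse c ^ i * ((c * s) ^ i / exp (c * s)))) \<longlongrightarrow>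
      (\<Sum>i\<le>degree p. coeff p i * (inverse c ^ i * 0))) at_top"
    by (intro tendsto_intros filterlim_compose[OF tendsto_power_div_exp_0]
        filterlim_tendsto_pos_mult_at_top[OF tendsto_const assms] filterlim_ident)
  also have "(\<lambda>s. \<Sum>i\<le>degree p. coeff p i * (inverse c ^ i * ((c * s) ^ i / exp (c * s)))) =
      (\<lambda>s. poly p s * exp (- (c * s)))"
    using assms by (auto simp: poly_altdef power_mult_distrib exp_minus field_simps sum_distrib_left sum_distrib_right sum_divide_distrib intro!: sum.cong)
  finally show ?thesis
    by (simp add: filterlim_at_right_to_top field_simps)
qed

text \<open>The derivative of p(1/t) exp(-c/t) is (c p(1/t) - p'(1/t)) exp(-c/t) / t^2; the factor
  1/t^2 becomes the monomial s^2 in s = 1/t.\<close>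

definition flat_step :: "real \<Rightarrow> real poly \<Rightarrow> real poly" where
  "flat_step c p = [:0, 0, 1:] * (smult c p - pderiv p)"

lemma flat_exp_deriv:
  assumes "c > 0"
  shows "(flat_exp p c has_real_derivative flat_exp (flat_step c p) c t) (at t)"
proof -
  consider "t > 0" | "t < 0" | "t = 0" by linarith
  then show ?thesis
  proof cases
    case 1
    have "((\<lambda>t. poly p (1 / t) * exp (- (c / t))) has_real_derivative
       flat_exp (flat_step c p) c t) (at t)"
      using 1 by (auto intro!: derivative_eq_intros DERIV_chain2[OF poly_DERIV] simp: flat_exp_def flat_step_def field_simps power2_eq_square)
    then show ?thesis
      by (rule has_field_derivative_transform_within_open[where S="{0<..}"]) (use 1 in \<open>auto simp: flat_exp_def\<close>)
  next
    case 2
    have "((\<lambda>t. 0) has_real_derivative flat_exp (flat_step c p) c t) (at t)"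
      using 2 by (auto simp: flat_exp_def)
    then show ?thesis
      by (rule has_field_derivative_transform_within_open[where S="{..<0}"]) (use 2 in \<open>auto simp: flat_exp_def\<close>)
  next
    case 3
    \<comment> \<open>The difference quotient at 0 from the right is again of flat form, since
      dividing by t multiplies \<open>p\<close> by s.\<close>
    have "((\<lambda>t. poly ([:0,1:] * p) (1 / t) * exp (- (c / t))) \<longlongrightarrow> 0) (at_right 0)"
      by (rule flat_exp_lim[OF assms])
    then have r: "((\<lambda>h. (flat_exp p c (0 + h) - flat_exp p c 0) / h) \<longlongrightarrow> 0) (at_right 0)"
      by (rule Lim_transform_eventually) (auto simp: eventually_at_right_field flat_exp_def intro!: exI[of _ 1])
    have l: "((\<lambda>h. (flat_exp p c (0 + h) - flat_exp p c 0) / h) \<longlongrightarrow> 0) (at_left 0)"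
      by (rule Lim_transform_eventually[of "\<lambda>_. 0"]) (auto simp: eventually_at_left_field flat_exp_def intro!: exI[of _ "-1"])
    show ?thesis using filterlim_split_at[OF l r]
      unfolding 3 DERIV_def by (simp add: flat_exp_def)
  qed
qed

text \<open>\<open>p\<close> must stay general in the induction, since each derivative replaces it
  by \<open>flat_step c p\<close>. The slopes s = 1 and s = -1 give the two one-sided cutoffs of an
  interval.\<close>

lemma Ck_flat:
  assumes "c > 0"
  shows "Ck k (\<lambda>x::real^'n. flat_exp p c (s * x $ i + b))"
proof (induction k arbitrary: p)
  have D: "((\<lambda>x::real^'n. flat_exp p c (s * x $ i + b)) has_derivative
      (\<lambda>h. flat_exp (flat_step c p) c (s * x $ i + b) * (s * h $ i))) (at x)" for x p
  proof -
    have "((\<lambda>x::real^'n. s * x $ i + b) has_derivative (\<lambda>h. s * h $ i)) (at x)"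
      by (auto intro!: derivative_eq_intros bounded_linear.has_derivative[OF bounded_linear_vec_nth] has_derivative_ident)
    from has_derivative_compose[OF this flat_exp_deriv[OF assms, THEN has_field_derivative_imp_has_derivative]]
    show ?thesis by simp
  qed
  have diff: "(\<lambda>x::real^'n. flat_exp p c (s * x $ i + b)) differentiable_on UNIV" for p
    using D by (auto simp: differentiable_on_def differentiable_def)
  { case 0
    show ?case using differentiable_imp_continuous_on[OF diff] by simp
  next
    case (Suc k)
    have "partial_deriv j (\<lambda>x::real^'n. flat_exp p c (s * x $ i + b)) =
      (\<lambda>x. flat_exp (flat_step c p) c (s * x $ i + b) * (s * axis j 1 $ i))" for j
      by (rule ext) (rule partial_deriv_eq[OF D])
    then show ?case using diff Suc by (auto intro!: Ck_mult Ck_const) }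
qed

text \<open>Each coordinate contributes a cutoff at either end of its interval. The rate 1 / (m + 1)
  tends to 0, so every positive factor exp(-c/t) increases to 1 and the bumps approximate the
  indicator of the open box.\<close>

definition bump :: "real ^ 'n \<Rightarrow> real ^ 'n \<Rightarrow> nat \<Rightarrow> real ^ 'n \<Rightarrow> real" where
  "bump a b m x = (\<Prod>i\<in>UNIV. flat_exp 1 (1 / real (Suc m)) (x $ i - a $ i) * flat_exp 1 (1 / real (Suc m)) (b $ i - x $ i))"

lemma bump_nonzero: "bump a b m x \<noteq> 0 \<longleftrightarrow> x \<in> box a b"
  by (auto simp: bump_def mem_box_cart flat_exp_def)

lemma bump_lim: "(\<lambda>m. bump a b m x) \<longlonglongrightarrow> indicator (box a b) x"
proof (cases "x \<in> box a b")
  case True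
  have "(\<lambda>m. exp (- (1 / real (Suc m) / t))) \<longlonglongrightarrow> exp (-(0 / t))" if "t > 0" for t
    using that by (intro tendsto_intros LIMSEQ_Suc lim_1_over_n) auto
  then have "(\<lambda>m. bump a b m x) \<longlonglongrightarrow> (\<Prod>i\<in>(UNIV::'a set). 1 * 1)"
    unfolding bump_def using True
    by (intro tendsto_prod tendsto_mult) (auto simp: mem_box_cart flat_exp_def)
  then show ?thesis using True by simp
next
  case False
  then have "bump a b m x = 0" for m using bump_nonzero by blast
  with False show ?thesis by simp
qed

lemma bump_bounds: "0 \<le> bump a b m x" "bump a b m x \<le> 1"
  unfolding bump_def
  by (auto simp: flat_exp_def intro!: prod_nonneg prod_le_1 mult_le_one)

lemma test_function_bump:
  assumes "cbox a b \<subseteq> \<Omega>"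
  shows "test_function \<Omega> (bump a b m)"
proof -
  have sub: "closure {x. bump a b m x \<noteq> 0} \<subseteq> cbox a b"
    unfolding bump_nonzero by (intro closure_minimal) (auto intro: box_subset_cbox[THEN subsetD])
  have "Ck k (bump a b m)" for k
  proof -
    have "Ck k (\<lambda>x. flat_exp 1 (1 / real (Suc m)) (1 * x $ i + - a $ i) * flat_exp 1 (1 / real (Suc m)) (-1 * x $ i + b $ i))" for i
      by (intro Ck_mult Ck_flat) auto
    then have "Ck k (\<lambda>x. flat_exp 1 (1 / real (Suc m)) (x $ i - a $ i) * flat_exp 1 (1 / real (Suc m)) (b $ i - x $ i))" for i
      by simp
    then show ?thesis unfolding bump_def[abs_def] by (intro Ck_prod) auto
  qed
  moreover have "compact (closure {x. bump a b m x \<noteq> 0})"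
    using sub by (meson bounded_cbox bounded_subset compact_closure closure_subset order_trans)
  ultimately show ?thesis using sub assms by (auto simp: test_function_def)
qed

section \<open>The fundamental lemma of the calculus of variations\<close>

lemma sets_lebesgue_on_borel:
  assumes "open \<Omega>" "A \<in> sets borel" shows "A \<inter> \<Omega> \<in> sets (lebesgue_on \<Omega>)"
  using assms by (auto simp: sets_restrict_space_iff)

lemma borel_measurable_on:
  "f \<in> borel_measurable borel \<Longrightarrow> f \<in> borel_measurable (lebesgue_on \<Omega>)"
  by (intro measurable_restrict_space1 measurable_completion) simp

lemma integrable_indicator_cbox:
  assumes "open \<Omega>"
  shows "integrable (lebesgue_on \<Omega>) (indicator (cbox a b) :: _ \<Rightarrow> real)"
proof -
  have "integrable lebesgue (\<lambda>x. indicator \<Omega> x *\<^sub>R indicator (cbox a b) x :: real)"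
    by (rule Bochner_Integration.integrable_bound[of _ "indicator (cbox a b)"])
       (use assms in \<open>auto simp: integrable_indicator_iff emeasure_lborel_cbox_eq split: split_indicator
          intro!: borel_measurable_times borel_measurable_indicator\<close>)
  then show ?thesis using assms by (subst integrable_restrict_space) auto
qed

text \<open>An L^2 function need not be integrable on an unbounded \<open>\<Omega>\<close>. After a
  cutoff by a box it is, because |t| \<le> t^2 + 1.\<close>

lemma integrable_L2_cbox:
  assumes "open \<Omega>" and [measurable]: "g \<in> borel_measurable (lebesgue_on \<Omega>)"
    and g2: "integrable (lebesgue_on \<Omega>) (\<lambda>x. (g x)\<^sup>2)"
  shows "integrable (lebesgue_on \<Omega>) (\<lambda>x. g x * indicator (cbox a b) x :: real)"
proof (rule Bochner_Integration.integrable_bound[of _ "\<lambda>x. (g x)\<^sup>2 + indicator (cbox a b) x"])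
  show "integrable (lebesgue_on \<Omega>) (\<lambda>x. (g x)\<^sup>2 + indicator (cbox a b) x)"
    using g2 integrable_indicator_cbox[OF assms(1)] by auto
  have [measurable]: "indicator (cbox a b) \<in> borel_measurable (lebesgue_on \<Omega>)" for a b
    by (rule borel_measurable_on) auto
  show "(\<lambda>x. g x * indicator (cbox a b) x :: real) \<in> borel_measurable (lebesgue_on \<Omega>)"
    by measurable
  have "\<bar>t\<bar> \<le> t\<^sup>2 + 1" for t :: real
    using zero_le_power2[of "\<bar>t\<bar> - 1/2"] by (simp add: power2_eq_square algebra_simps)
  then show "AE x in lebesgue_on \<Omega>. norm (g x * indicator (cbox a b) x) \<le> norm ((g x)\<^sup>2 + indicator (cbox a b) x)"
    by (auto split: split_indicator)
qed

text \<open>The bumps converge pointwise to the indicator of the open box and lie below that of the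
  closed one, so dominated convergence passes from test functions to boxes.\<close>

lemma integral_box_zero:
  assumes \<Omega>: "open \<Omega>" and g[measurable]: "g \<in> borel_measurable (lebesgue_on \<Omega>)"
    and g2: "integrable (lebesgue_on \<Omega>) (\<lambda>x. (g x)\<^sup>2)"
    and test: "\<And>\<psi>. test_function \<Omega> \<psi> \<Longrightarrow> integral\<^sup>L (lebesgue_on \<Omega>) (\<lambda>x. g x * \<psi> x) = (0::real)"
    and sub: "cbox a b \<subseteq> \<Omega>"
  shows "integral\<^sup>L (lebesgue_on \<Omega>) (\<lambda>x. g x * indicator (box a b) x) = 0"
proof -
  have [measurable]: "bump a b m \<in> borel_measurable (lebesgue_on \<Omega>)" for m
    using test_function_bump[OF sub, of m] unfolding test_function_def
    by (intro borel_measurable_on borel_measurable_continuous_onI) (metis Ck.simps(1))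
  have [measurable]: "indicator (box a b) \<in> borel_measurable (lebesgue_on \<Omega>)"
    by (rule borel_measurable_on) auto
  have "(\<lambda>m. integral\<^sup>L (lebesgue_on \<Omega>) (\<lambda>x. g x * bump a b m x)) \<longlonglongrightarrow>
     integral\<^sup>L (lebesgue_on \<Omega>) (\<lambda>x. g x * indicator (box a b) x)"
  proof (rule integral_dominated_convergence[where w="\<lambda>x. \<bar>g x * indicator (cbox a b) x\<bar>"])
    show "integrable (lebesgue_on \<Omega>) (\<lambda>x. \<bar>g x * indicator (cbox a b) x\<bar>)"
      using integrable_L2_cbox[OF \<Omega> g g2] by auto
    show "AE x in lebesgue_on \<Omega>. (\<lambda>m. g x * bump a b m x) \<longlonglongrightarrow> g x * indicator (box a b) x"
      by (intro AE_I2 tendsto_mult tendsto_const bump_lim)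
    show "AE x in lebesgue_on \<Omega>. norm (g x * bump a b m x) \<le> \<bar>g x * indicator (cbox a b) x\<bar>" for m
    proof (rule AE_I2)
      fix x
      have "\<bar>bump a b m x\<bar> \<le> indicator (cbox a b) x"
        using bump_bounds[of a b m x] bump_nonzero[of a b m x] box_subset_cbox[of a b]
        by (auto split: split_indicator)
      from mult_left_mono[OF this, of "\<bar>g x\<bar>"]
      show "norm (g x * bump a b m x) \<le> \<bar>g x * indicator (cbox a b) x\<bar>"
        by (simp add: abs_mult)
    qed
  qed auto
  with test[OF test_function_bump[OF sub]] show ?thesis
    by (simp add: LIMSEQ_const_iff)
qed

text \<open>Open boxes are stable under intersection and generate the Borel sets, and the Borel sets
  over which the integrable \<open>h\<close> has integral zero are closed under complements and
  disjoint countable unions. So all Borel sets are reached, in particular those that fill up {h > 0}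
  and {h < 0} up to null sets.\<close>

lemma fundamental_lemma_box:
  assumes \<Omega>: "open \<Omega>" and g[measurable]: "g \<in> borel_measurable (lebesgue_on \<Omega>)"
    and g2: "integrable (lebesgue_on \<Omega>) (\<lambda>x. (g x)\<^sup>2)"
    and test: "\<And>\<psi>. test_function \<Omega> \<psi> \<Longrightarrow> integral\<^sup>L (lebesgue_on \<Omega>) (\<lambda>x. g x * \<psi> x) = (0::real)"
    and sub: "cbox a b \<subseteq> \<Omega>"
  shows "AE x in lebesgue_on \<Omega>. x \<in> box a b \<longrightarrow> g x = 0"
proof -
  let ?M = "lebesgue_on \<Omega>"
  define h where "h x = g x * indicator (box a b) x" for x
  have [measurable]: "indicator (box a b) \<in> borel_measurable ?M" for a b
    by (rule borel_measurable_on) auto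
  have h_meas[measurable]: "h \<in> borel_measurable ?M" unfolding h_def by measurable
  have h_int: "integrable ?M h"
    by (rule Bochner_Integration.integrable_bound[OF integrable_L2_cbox[OF \<Omega> g g2, of a b]])
       (auto simp: h_def split: split_indicator intro!: AE_I2 dest: box_subset_cbox[THEN subsetD])
  have seti: "set_integrable ?M (A \<inter> \<Omega>) h" if "A \<in> sets borel" for A
    unfolding set_integrable_def
    using integrable_mult_indicator[OF sets_lebesgue_on_borel[OF \<Omega> that] h_int] .
  have zero: "set_lebesgue_integral ?M (A \<inter> \<Omega>) h = 0" if "A \<in> sets borel" for A
  proof -
    \<comment> \<open>Complements require the integral over the whole domain; it is zero because
      \<open>h\<close> already carries the indicator of the box.\<close>
    have whole: "set_lebesgue_integral ?M \<Omega> h = 0"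
    proof -
      have "set_lebesgue_integral ?M \<Omega> h = integral\<^sup>L ?M (\<lambda>x. g x * indicator (box a b) x)"
        unfolding set_lebesgue_integral_def h_def by (intro Bochner_Integration.integral_cong) auto
      then show ?thesis using integral_box_zero[OF \<Omega> g g2 _ sub] test by simp
    qed
    let ?G = "range (\<lambda>(a::real^'a, b). box a b)"
    have eq: "sigma_sets UNIV ?G = sets borel" unfolding borel_eq_box by simp
    have "Int_stable ?G" "?G \<subseteq> Pow UNIV" "A \<in> sigma_sets UNIV ?G"
      using that eq by (auto simp: Int_stable_def box_Int_box)
    then show ?thesis
    proof (induction rule: sigma_sets_induct_disjoint)
      case (basic A)
      then obtain c d where A: "A = box c d" by auto
      obtain p q where pq: "box a b \<inter> box c d = box p q" by (auto simp: box_Int_box)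
      show ?case
      proof (cases "box p q = {}")
        case True
        then have "h x = 0" if "x \<in> A" for x
          using pq A that by (auto simp: h_def split: split_indicator)
        then show ?thesis unfolding set_lebesgue_integral_def
          by (intro integral_eq_zero_AE AE_I2) (auto split: split_indicator simp: A)
      next
        case False
        \<comment> \<open>Nonemptiness makes the closed box the closure of the open one; otherwise
          the equation for \<open>p\<close> and \<open>q\<close> would not place the closed box
          inside \<open>cbox a b\<close>.\<close>
        have "cbox p q = closure (box p q)" using False by (simp add: closure_box)
        also have "\<dots> \<subseteq> cbox a b" 
          using pq by (intro closure_minimal) (auto intro: box_subset_cbox[THEN subsetD])
        finally have "cbox p q \<subseteq> \<Omega>" using sub by auto
        from integral_box_zero[OF \<Omega> g g2 _ this] test
        have "integral\<^sup>L ?M (\<lambda>x. g x * indicator (box p q) x) = 0" by simp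
        also have "integral\<^sup>L ?M (\<lambda>x. g x * indicator (box p q) x) = set_lebesgue_integral ?M (A \<inter> \<Omega>) h"
          unfolding set_lebesgue_integral_def h_def
          using A pq[symmetric] by (intro Bochner_Integration.integral_cong) (auto split: split_indicator)
        finally show ?thesis by simp
      qed
    next
      case empty
      show ?case by (simp add: set_lebesgue_integral_def)
    next
      case (compl A)
      then have A: "A \<in> sets borel" using eq by simp
      have "set_lebesgue_integral ?M ((A \<inter> \<Omega>) \<union> ((UNIV - A) \<inter> \<Omega>)) h =
        set_lebesgue_integral ?M (A \<inter> \<Omega>) h + set_lebesgue_integral ?M ((UNIV - A) \<inter> \<Omega>) h"
        using A by (intro set_integral_Un seti) auto
      moreover have "(A \<inter> \<Omega>) \<union> ((UNIV - A) \<inter> \<Omega>) = \<Omega>" by auto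
      ultimately show ?case using whole compl by simp
    next
      case (union A)
      have A: "A i \<in> sets borel" for i using union eq by auto
      have "set_lebesgue_integral ?M (\<Union>i. A i \<inter> \<Omega>) h = (\<Sum>i. set_lebesgue_integral ?M (A i \<inter> \<Omega>) h)"
      proof (rule lebesgue_integral_countable_add)
        show "A i \<inter> \<Omega> \<in> sets ?M" for i by (rule sets_lebesgue_on_borel[OF \<Omega> A])
        show "A i \<inter> \<Omega> \<inter> (A j \<inter> \<Omega>) = {}" if "i \<noteq> j" for i j
          using union(1) that by (auto simp: disjoint_family_on_def)
        have "(\<Union>i. A i \<inter> \<Omega>) = (\<Union>i. A i) \<inter> \<Omega>" by auto
        then show "set_integrable ?M (\<Union>i. A i \<inter> \<Omega>) h" using seti[of "\<Union>i. A i"] A by auto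
      qed
      moreover have "(\<Union>i. A i \<inter> \<Omega>) = (\<Union>i. A i) \<inter> \<Omega>" by auto
      ultimately show ?case using union by simp
    qed
  qed
  have nonpos: "AE x in ?M. s * h x \<le> 0" if s: "s \<noteq> 0" for s :: real
  proof -
    define A where "A = {x \<in> \<Omega>. 0 < s * h x}"
    have "A \<in> sets ?M" unfolding A_def
      using measurable_sets[of "\<lambda>x. s * h x" ?M borel "{0<..}"] by (simp add: vimage_def Int_def conj_commute)
    then have "A \<in> sets lebesgue" using \<Omega> by (auto simp: sets_restrict_space_iff)
    \<comment> \<open>\<open>A\<close> is only Lebesgue measurable, whereas \<open>zero\<close>
      speaks of Borel sets; an F_sigma subset of \<open>A\<close> differs from it by a null
      set.\<close>
    then obtain C T where CT: "fsigma C" "T \<in> null_sets lebesgue" "C \<union> T = A" "disjnt C T"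
      using lebesgue_set_almost_fsigma by metis
    have C: "C \<in> sets borel"
      using CT(1) unfolding fsigma.simps by auto
    have CO: "C \<inter> \<Omega> = C" using CT A_def by auto
    have "integral\<^sup>L ?M (\<lambda>x. indicator C x *\<^sub>R (s * h x)) = s * set_lebesgue_integral ?M (C \<inter> \<Omega>) h"
      unfolding CO set_lebesgue_integral_def by (simp add: mult.left_commute)
    then have "integral\<^sup>L ?M (\<lambda>x. indicator C x *\<^sub>R (s * h x)) = 0" using zero[OF C] by simp
    moreover have "integrable ?M (\<lambda>x. indicator C x *\<^sub>R (s * h x))"
      using integrable_mult_indicator[OF sets_lebesgue_on_borel[OF \<Omega> C] integrable_mult_right[OF h_int], of s] CO by simp
    moreover have "AE x in ?M. 0 \<le> indicator C x *\<^sub>R (s * h x)"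
    proof -
      have "0 < s * h x" if "x \<in> C" for x using that CT(3) unfolding A_def by blast
      then show ?thesis by (intro AE_I2) (auto intro: less_imp_le split: split_indicator)
    qed
    ultimately have "AE x in ?M. indicator C x *\<^sub>R (s * h x) = 0"
      by (subst (asm) integral_nonneg_eq_0_iff_AE) auto
    moreover have "AE x in ?M. x \<notin> T"
      using CT(2) \<Omega> by (auto simp: AE_restrict_space_iff intro: AE_mp[OF AE_not_in])
    moreover have "AE x in ?M. x \<in> \<Omega>" by (rule AE_I2) simp
    ultimately show ?thesis
    proof eventually_elim
      case (elim x)
      have "x \<in> C \<longleftrightarrow> 0 < s * h x" using CT(3) elim A_def by auto
      with elim show ?case by (auto split: split_indicator_asm)
    qed
  qed
  have "AE x in ?M. h x = 0" using nonpos[of 1] nonpos[of "-1"] by auto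
  then show ?thesis by eventually_elim (auto simp: h_def)
qed

text \<open>An open set is a countable union of closed boxes, and the faces of each box form a null
  set.\<close>

lemma fundamental_lemma:
  assumes \<Omega>: "open \<Omega>" and g[measurable]: "g \<in> borel_measurable (lebesgue_on \<Omega>)"
    and g2: "integrable (lebesgue_on \<Omega>) (\<lambda>x. (g x)\<^sup>2)"
    and test: "\<And>\<psi>. test_function \<Omega> \<psi> \<Longrightarrow> integral\<^sup>L (lebesgue_on \<Omega>) (\<lambda>x. g x * \<psi> x) = (0::real)"
  shows "AE x in lebesgue_on \<Omega>. g x = 0"
proof -
  obtain D where D: "countable D" "D \<subseteq> Pow \<Omega>" "\<And>X. X \<in> D \<Longrightarrow> \<exists>a b. X = cbox a b" "\<Union>D = \<Omega>"
    using open_countable_Union_open_cbox[OF \<Omega>] by metis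
  have "AE x in lebesgue_on \<Omega>. x \<in> X \<longrightarrow> g x = 0" if XD: "X \<in> D" for X
  proof -
    obtain a b where X: "X = cbox a b" using D(3)[OF XD] by auto
    have "AE x in lebesgue_on \<Omega>. x \<notin> cbox a b - box a b"
      using \<Omega> null_sets_cbox_Diff_box[of a b] 
      by (subst AE_restrict_space_iff) (auto intro: AE_mp[OF AE_not_in[OF null_sets_completionI]])
    moreover have "AE x in lebesgue_on \<Omega>. x \<in> box a b \<longrightarrow> g x = 0"
      by (rule fundamental_lemma_box[OF \<Omega> g g2 test]) (use D(2) XD X test in auto)
    ultimately show ?thesis by eventually_elim (auto simp: X)
  qed
  then have ae: "AE x in lebesgue_on \<Omega>. \<forall>X\<in>D. x \<in> X \<longrightarrow> g x = 0"
    by (subst AE_ball_countable[OF D(1)]) blast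
  have "AE x in lebesgue_on \<Omega>. x \<in> \<Omega>" by (rule AE_I2) simp
  with ae show ?thesis by eventually_elim (use D(4) in blast)
qed

section \<open>\<open>L\<^sup>2\<close> spaces and integration by parts\<close>

lemma borel_measurable_vec_lambda:
  fixes f :: "'n::finite \<Rightarrow> 'a \<Rightarrow> 'b::euclidean_space"
  assumes "\<And>i. f i \<in> borel_measurable M"
  shows "(\<lambda>x. \<chi> i. f i x) \<in> borel_measurable M"
  by (subst borel_measurable_euclidean_space)
     (auto simp: Basis_vec_def inner_axis intro!: borel_measurable_inner assms)

lemma borel_measurable_vec_nth:
  fixes f :: "'a \<Rightarrow> 'b::euclidean_space ^ 'n"
  assumes "f \<in> borel_measurable M"
  shows "(\<lambda>x. f x $ i) \<in> borel_measurable M"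
  by (rule borel_measurable_continuous_on[OF _ assms]) (intro continuous_intros)

lemma L2_measurable: "u \<in> L2 \<Omega> \<Longrightarrow> u \<in> borel_measurable (lebesgue_on \<Omega>)"
  by (simp add: L2_def)

lemma L2_integrable: "u \<in> L2 \<Omega> \<Longrightarrow> integrable (lebesgue_on \<Omega>) (\<lambda>x. (norm (u x))\<^sup>2)"
  by (simp add: L2_def)

lemma mult_le_sum_squares: "a * b \<le> a\<^sup>2 + b\<^sup>2" for a b :: real
  using sum_squares_bound[of a b] zero_le_power2[of a] zero_le_power2[of b] by linarith

lemma L2_inner_integrable:
  assumes "u \<in> L2 \<Omega>" "v \<in> L2 \<Omega>"
  shows "integrable (lebesgue_on \<Omega>) (\<lambda>x. u x \<bullet> v x)"
proof (rule Bochner_Integration.integrable_bound[of _ "\<lambda>x. (norm (u x))\<^sup>2 + (norm (v x))\<^sup>2"])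
  show "integrable (lebesgue_on \<Omega>) (\<lambda>x. (norm (u x))\<^sup>2 + (norm (v x))\<^sup>2)"
    using assms by (intro Bochner_Integration.integrable_add L2_integrable)
  show "(\<lambda>x. u x \<bullet> v x) \<in> borel_measurable (lebesgue_on \<Omega>)"
    using assms by (intro borel_measurable_inner L2_measurable)
  show "AE x in lebesgue_on \<Omega>. norm (u x \<bullet> v x) \<le> norm ((norm (u x))\<^sup>2 + (norm (v x))\<^sup>2)"
    by (rule AE_I2) (auto intro: order_trans[OF Cauchy_Schwarz_ineq2 order_trans[OF mult_le_sum_squares]])
qed

lemma L2_scaleR:
  assumes "u \<in> L2 \<Omega>"
  shows "(\<lambda>x. c *\<^sub>R u x) \<in> L2 \<Omega>"
  using assms by (auto simp: L2_def power_mult_distrib)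

lemma L2_add:
  assumes "u \<in> L2 \<Omega>" "v \<in> L2 \<Omega>"
  shows "(\<lambda>x. u x + v x) \<in> L2 \<Omega>"
proof -
  have "integrable (lebesgue_on \<Omega>) (\<lambda>x. (norm (u x))\<^sup>2 + (norm (v x))\<^sup>2 + 2 * (u x \<bullet> v x))"
    using assms by (intro Bochner_Integration.integrable_add L2_integrable integrable_mult_right L2_inner_integrable)
  also have "(\<lambda>x. (norm (u x))\<^sup>2 + (norm (v x))\<^sup>2 + 2 * (u x \<bullet> v x)) = (\<lambda>x. (norm (u x + v x))\<^sup>2)"
    by (auto simp: power2_norm_eq_inner inner_add_left inner_add_right inner_commute)
  finally show ?thesis using assms by (auto simp: L2_def)
qed

lemma L2_zero: "(\<lambda>x. 0) \<in> L2 \<Omega>" by (simp add: L2_def)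

lemma L2_sum: "(\<And>a. a \<in> A \<Longrightarrow> u a \<in> L2 \<Omega>) \<Longrightarrow> (\<lambda>x. \<Sum>a\<in>A. u a x) \<in> L2 \<Omega>"
  by (induction A rule: infinite_finite_induct) (auto intro: L2_zero L2_add)

lemma L2_diff:
  assumes "u \<in> L2 \<Omega>" "v \<in> L2 \<Omega>"
  shows "(\<lambda>x. u x - v x) \<in> L2 \<Omega>"
  using L2_add[OF assms(1) L2_scaleR[OF assms(2), of "-1"]] by simp

lemma L2_bounded:
  assumes "u \<in> L2 \<Omega>" "v \<in> borel_measurable (lebesgue_on \<Omega>)" "\<And>x. norm (v x) \<le> norm (u x)"
  shows "v \<in> L2 \<Omega>"
  using assms(2) unfolding L2_def
  by (auto intro!: Bochner_Integration.integrable_bound[OF L2_integrable[OF assms(1)]] AE_I2 power_mono assms(3))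

lemma L2_vec_nth:
  fixes u :: "real ^ 'n \<Rightarrow> 'b::euclidean_space ^ 'm"
  shows "u \<in> L2 \<Omega> \<Longrightarrow> (\<lambda>x. u x $ i) \<in> L2 \<Omega>"
  by (rule L2_bounded) (auto intro: borel_measurable_vec_nth L2_measurable Finite_Cartesian_Product.norm_nth_le)

lemma L2_vec_lambda:
  fixes u :: "'m::finite \<Rightarrow> real ^ 'n \<Rightarrow> 'b::euclidean_space"
  assumes "\<And>i. u i \<in> L2 \<Omega>"
  shows "(\<lambda>x. \<chi> i. u i x) \<in> L2 \<Omega>"
proof -
  have "(norm (\<chi> i. u i x))\<^sup>2 = (\<Sum>i\<in>UNIV. (norm (u i x))\<^sup>2)" for x
    by (simp add: norm_vec_def L2_set_def sum_nonneg)
  then show ?thesis using assms by (auto simp: L2_def intro!: borel_measurable_vec_lambda)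
qed

lemma L2_inner_commute: "L2_inner \<Omega> u v = L2_inner \<Omega> v u"
  by (simp add: L2_inner_def inner_commute)

lemma L2_inner_add_left:
  assumes "u \<in> L2 \<Omega>" "v \<in> L2 \<Omega>" "w \<in> L2 \<Omega>"
  shows "L2_inner \<Omega> (\<lambda>x. u x + v x) w = L2_inner \<Omega> u w + L2_inner \<Omega> v w"
  unfolding L2_inner_def inner_add_left
  using assms by (intro Bochner_Integration.integral_add L2_inner_integrable)

lemma L2_inner_scaleR_left: "L2_inner \<Omega> (\<lambda>x. c *\<^sub>R u x) w = c * L2_inner \<Omega> u w"
  unfolding L2_inner_def by simp

lemma L2_inner_diff_left:
  assumes "u \<in> L2 \<Omega>" "v \<in> L2 \<Omega>" "w \<in> L2 \<Omega>"
  shows "L2_inner \<Omega> (\<lambda>x. u x - v x) w = L2_inner \<Omega> u w - L2_inner \<Omega> v w"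
  unfolding L2_inner_def inner_diff_left
  using assms by (intro Bochner_Integration.integral_diff L2_inner_integrable)

lemma L2_inner_sum_left:
  assumes "\<And>a. a \<in> A \<Longrightarrow> u a \<in> L2 \<Omega>" "w \<in> L2 \<Omega>"
  shows "L2_inner \<Omega> (\<lambda>x. \<Sum>a\<in>A. u a x) w = (\<Sum>a\<in>A. L2_inner \<Omega> (u a) w)"
  unfolding L2_inner_def inner_sum_left
  using assms by (intro Bochner_Integration.integral_sum L2_inner_integrable)

lemma L2_inner_cong_AE:
  assumes "AE x in lebesgue_on \<Omega>. u x = u' x" "AE x in lebesgue_on \<Omega>. v x = v' x"
    and "u \<in> L2 \<Omega>" "v \<in> L2 \<Omega>" "u' \<in> L2 \<Omega>" "v' \<in> L2 \<Omega>"
  shows "L2_inner \<Omega> u v = L2_inner \<Omega> u' v'"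
  unfolding L2_inner_def
proof (rule integral_cong_AE)
  show "AE x in lebesgue_on \<Omega>. u x \<bullet> v x = u' x \<bullet> v' x"
    using assms(1,2) by eventually_elim simp
qed (use assms in \<open>auto intro: borel_measurable_inner L2_measurable\<close>)

lemma L2_inner_nonneg: "0 \<le> L2_inner \<Omega> u u"
  by (auto simp: L2_inner_def)

lemma L2_norm_nonneg: "0 \<le> L2_norm \<Omega> u"
  by (simp add: L2_norm_def L2_inner_nonneg)

lemma L2_norm_square: "(L2_norm \<Omega> u)\<^sup>2 = L2_inner \<Omega> u u"
  by (simp add: L2_norm_def L2_inner_nonneg)

lemma L2_inner_young:
  assumes "u \<in> L2 \<Omega>" "v \<in> L2 \<Omega>"
  shows "\<bar>L2_inner \<Omega> u v\<bar> \<le> ((L2_norm \<Omega> u)\<^sup>2 + (L2_norm \<Omega> v)\<^sup>2) / 2"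
proof -
  have "2 * \<bar>L2_inner \<Omega> u v\<bar> = \<bar>integral\<^sup>L (lebesgue_on \<Omega>) (\<lambda>x. 2 * (u x \<bullet> v x))\<bar>"
    by (simp add: L2_inner_def abs_mult)
  also have "\<dots> \<le> integral\<^sup>L (lebesgue_on \<Omega>) (\<lambda>x. u x \<bullet> u x + v x \<bullet> v x)"
  proof (rule integral_abs_bound[THEN order_trans], rule integral_mono)
    show "\<bar>2 * (u x \<bullet> v x)\<bar> \<le> u x \<bullet> u x + v x \<bullet> v x" for x
      using inner_ge_zero[of "u x - v x"] inner_ge_zero[of "u x + v x"]
      by (auto simp: algebra_simps inner_commute abs_le_iff)
  qed (use assms in \<open>auto intro!: L2_inner_integrable\<close>)
  also have "\<dots> = L2_inner \<Omega> u u + L2_inner \<Omega> v v"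
    unfolding L2_inner_def using assms by (intro Bochner_Integration.integral_add L2_inner_integrable)
  finally show ?thesis by (simp add: L2_norm_square)
qed

lemma L2_norm_add_square:
  assumes "u \<in> L2 \<Omega>" "v \<in> L2 \<Omega>"
  shows "(L2_norm \<Omega> (\<lambda>x. u x + v x))\<^sup>2 \<le> 2 * (L2_norm \<Omega> u)\<^sup>2 + 2 * (L2_norm \<Omega> v)\<^sup>2"
proof -
  have "(L2_norm \<Omega> (\<lambda>x. u x + v x))\<^sup>2 = (L2_norm \<Omega> u)\<^sup>2 + 2 * L2_inner \<Omega> u v + (L2_norm \<Omega> v)\<^sup>2"
    using assms L2_add[OF assms] L2_inner_commute[of \<Omega> u "\<lambda>x. u x + v x"]
      L2_inner_commute[of \<Omega> v "\<lambda>x. u x + v x"] L2_inner_commute[of \<Omega> v u]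
    by (simp add: L2_norm_square L2_inner_add_left)
  then show ?thesis using L2_inner_young[OF assms] by (simp add: abs_le_iff)
qed

section \<open>Integration by parts for compactly supported functions\<close>

lemma integrable_compact_support:
  fixes h :: "real ^ 'n \<Rightarrow> real"
  assumes "continuous_on UNIV h" "compact K" "\<And>x. x \<notin> K \<Longrightarrow> h x = 0"
  shows "integrable lborel h"
proof -
  have "integrable lborel (\<lambda>x. indicator K x *\<^sub>R h x)"
    using assms by (intro borel_integrable_compact) (auto intro: continuous_on_subset)
  also have "(\<lambda>x. indicator K x *\<^sub>R h x) = h"
    using assms(3) by (auto split: split_indicator)
  finally show ?thesis .
qed

text \<open>Translation invariance and Fubini's theorem are applied to \<open>lborel\<close>;
  extension by zero links it to \<open>lebesgue_on \<Omega>\<close>, the measure of the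
  definitions.\<close>

lemma lebesgue_on_eq_lborel:
  fixes h :: "real ^ 'n \<Rightarrow> real"
  assumes "open \<Omega>" "h \<in> borel_measurable borel" "\<And>x. x \<notin> \<Omega> \<Longrightarrow> h x = 0"
  shows "integral\<^sup>L (lebesgue_on \<Omega>) h = integral\<^sup>L lborel h"
    and "integrable (lebesgue_on \<Omega>) h \<longleftrightarrow> integrable lborel h"
proof -
  have "(\<lambda>x. indicator \<Omega> x *\<^sub>R h x) = h"
    using assms(3) by (auto split: split_indicator)
  then show "integral\<^sup>L (lebesgue_on \<Omega>) h = integral\<^sup>L lborel h"
    "integrable (lebesgue_on \<Omega>) h \<longleftrightarrow> integrable lborel h"
    using assms by (auto simp: integral_restrict_space integrable_restrict_space integral_completion integrable_completion)
qed

text \<open>Off its closed support the function vanishes on an open neighbourhood, so its partial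
  derivatives vanish there as well.\<close>

lemma test_functionD:
  assumes "test_function \<Omega> \<psi>"
  obtains K where "compact K" "K \<subseteq> \<Omega>" "\<And>x. x \<notin> K \<Longrightarrow> \<psi> x = 0" "\<And>x i. x \<notin> K \<Longrightarrow> partial_deriv i \<psi> x = 0"
    "continuous_on UNIV \<psi>" "\<psi> differentiable_on UNIV" "\<And>i. continuous_on UNIV (partial_deriv i \<psi>)"
proof -
  let ?K = "closure {x. \<psi> x \<noteq> 0}"
  have K: "compact ?K" "?K \<subseteq> \<Omega>" using assms by (simp_all add: test_function_def)
  have z: "\<psi> x = 0" if "x \<notin> ?K" for x
  proof (rule ccontr)
    assume "\<psi> x \<noteq> 0"
    then have "x \<in> ?K" by (intro closure_subset[THEN subsetD]) simp
    with that show False by blast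
  qed
  have "Ck 0 \<psi>" "Ck (Suc 0) \<psi>" using assms unfolding test_function_def by blast+
  then have c: "continuous_on UNIV \<psi>" "\<psi> differentiable_on UNIV" "\<And>i. continuous_on UNIV (partial_deriv i \<psi>)"
    by simp_all
  have p: "partial_deriv i \<psi> x = 0" if "x \<notin> ?K" for x i
  proof -
    have "(\<psi> has_derivative (\<lambda>h. 0)) (at x)"
      by (rule has_derivative_transform_within_open[OF has_derivative_const, of "- ?K"])
         (use that in \<open>auto intro: z[symmetric]\<close>)
    from partial_deriv_eq[OF this] show ?thesis .
  qed
  show ?thesis by (rule that[OF K z p c])
qed

lemma DERIV_along_axis:
  fixes F :: "real ^ 'n \<Rightarrow> real"
  assumes "F differentiable_on UNIV"
  shows "((\<lambda>t. F (x + t *\<^sub>R axis i 1)) has_real_derivative partial_deriv i F (x + t *\<^sub>R axis i 1)) (at t)"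
proof -
  have 1: "((\<lambda>t. x + t *\<^sub>R axis i (1::real)) has_derivative (\<lambda>h. h *\<^sub>R axis i 1)) (at t)"
    using has_derivative_add[OF has_derivative_const[of x] has_derivative_scaleR_left[OF has_derivative_ident]] by simp
  note D = has_derivative_frechet[OF assms, of "x + t *\<^sub>R axis i 1"]
  note l = has_derivative_linear[OF D]
  have "(\<lambda>h. frechet_derivative F (at (x + t *\<^sub>R axis i 1)) (h *\<^sub>R axis i 1)) = (*) (partial_deriv i F (x + t *\<^sub>R axis i 1))"
    by (rule ext) (simp add: partial_deriv_def linear_cmul[OF l])
  with has_derivative_compose[OF 1 D] show ?thesis
    by (simp only: has_field_derivative_def)
qed

lemma integral_lborel_translation:
  fixes F :: "'a::euclidean_space \<Rightarrow> real"
  assumes [measurable]: "F \<in> borel_measurable borel"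
  shows "integral\<^sup>L lborel (\<lambda>x. F (c + x)) = integral\<^sup>L lborel F"
proof -
  have "integral\<^sup>L lborel F = integral\<^sup>L (distr lborel borel ((+) c)) F" by (simp add: lborel_distr_plus)
  also have "\<dots> = integral\<^sup>L lborel (\<lambda>x. F (c + x))" by (intro integral_distr) auto
  finally show ?thesis ..
qed

lemma integrable_lborel_translation:
  fixes F :: "'a::euclidean_space \<Rightarrow> real"
  assumes [measurable]: "F \<in> borel_measurable borel" and "integrable lborel F"
  shows "integrable lborel (\<lambda>x. F (c + x))"
proof -
  have "integrable (distr lborel borel ((+) c)) F" using assms by (simp add: lborel_distr_plus)
  then show ?thesis by (subst (asm) integrable_distr_eq) auto
qed

text \<open>By translation invariance every difference quotient of \<open>F\<close> has integral
  zero; dominated convergence lets the step tend to 0.\<close>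

lemma integral_partial_deriv_zero:
  fixes F :: "real ^ 'n \<Rightarrow> real"
  assumes diff: "F differentiable_on UNIV" and cont: "continuous_on UNIV (partial_deriv i F)"
    and K: "compact K" "\<And>x. x \<notin> K \<Longrightarrow> F x = 0" "\<And>x. x \<notin> K \<Longrightarrow> partial_deriv i F x = 0"
  shows "integral\<^sup>L lborel (partial_deriv i F) = 0"
proof -
  let ?e = "axis i 1 :: real ^ 'n"
  obtain R where R: "\<And>x. x \<in> K \<Longrightarrow> norm x \<le> R" using compact_imp_bounded[OF K(1)] by (auto simp: bounded_iff)
  have "bounded (partial_deriv i F ` K)"
    using K(1) cont by (intro compact_imp_bounded compact_continuous_image) (auto intro: continuous_on_subset)
  then obtain B0 where B0: "\<And>x. x \<in> K \<Longrightarrow> \<bar>partial_deriv i F x\<bar> \<le> B0" by (auto simp: bounded_iff)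
  \<comment> \<open>If \<open>K\<close> is empty, \<open>B0\<close> may be negative.\<close>
  define B where "B = max B0 0"
  have B: "\<bar>partial_deriv i F x\<bar> \<le> B" for x
    using B0[of x] K(3)[of x] unfolding B_def by (cases "x \<in> K") auto
  have Fc: "continuous_on UNIV F" using diff by (rule differentiable_imp_continuous_on)
  have [measurable]: "F \<in> borel_measurable borel" using Fc by (rule borel_measurable_continuous_onI)
  have [measurable]: "partial_deriv i F \<in> borel_measurable borel" using cont by (rule borel_measurable_continuous_onI)
  have Fi: "integrable lborel F" using Fc K by (intro integrable_compact_support)
  define D where "D m x = real (Suc m) * (F ((1 / real (Suc m)) *\<^sub>R ?e + x) - F x)" for m x
  have [measurable]: "D m \<in> borel_measurable borel" for m unfolding D_def by measurable
  have "integral\<^sup>L lborel (D m) = 0" for m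
    unfolding D_def using Fi integrable_lborel_translation[OF _ Fi] integral_lborel_translation[of F]
    by simp
  moreover have "(\<lambda>m. integral\<^sup>L lborel (D m)) \<longlonglongrightarrow> integral\<^sup>L lborel (partial_deriv i F)"
  \<comment> \<open>The steps have length at most 1, so all quotients vanish outside the ball of
    radius R + 1; the mean value theorem bounds them by \<open>B\<close>.\<close>
  proof (rule integral_dominated_convergence[where w="\<lambda>x. B * indicator (cball 0 (R + 1)) x"])
    show "integrable lborel (\<lambda>x. B * indicator (cball 0 (R + 1)) x :: real)"
      by (intro integrable_mult_right integrable_real_indicator emeasure_bounded_finite) auto
    show "AE x in lborel. (\<lambda>m. D m x) \<longlonglongrightarrow> partial_deriv i F x"
    proof (rule AE_I2)
      fix x
      have 1: "((\<lambda>h. (F (x + (0 + h) *\<^sub>R ?e) - F (x + 0 *\<^sub>R ?e)) / h) \<longlongrightarrow> partial_deriv i F x) (at 0)"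
        using DERIV_along_axis[OF diff, of x i 0] unfolding DERIV_def by simp
      have 2: "filterlim (\<lambda>m. 1 / real (Suc m)) (at 0) sequentially"
        using LIMSEQ_inverse_real_of_nat by (auto simp: filterlim_at inverse_eq_divide simp del: of_nat_Suc)
      have "((\<lambda>m. (F (x + (0 + 1 / real (Suc m)) *\<^sub>R ?e) - F (x + 0 *\<^sub>R ?e)) / (1 / real (Suc m))) \<longlonglongrightarrow> partial_deriv i F x)"
        using filterlim_compose[OF 1 2] by simp
      then show "(\<lambda>m. D m x) \<longlonglongrightarrow> partial_deriv i F x"
        by (simp add: D_def add.commute mult.commute)
    qed
    show "AE x in lborel. norm (D m x) \<le> B * indicator (cball 0 (R + 1)) x" for m
    proof (rule AE_I2)
      fix x
      let ?h = "1 / real (Suc m)"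
      have "\<exists>z>0. z < ?h \<and> F (x + ?h *\<^sub>R ?e) - F (x + 0 *\<^sub>R ?e) = (?h - 0) * partial_deriv i F (x + z *\<^sub>R ?e)"
        by (rule MVT2[where f="\<lambda>t. F (x + t *\<^sub>R ?e)"]) (simp, rule DERIV_along_axis[OF diff])
      then obtain z where z: "F (x + ?h *\<^sub>R ?e) - F (x + 0 *\<^sub>R ?e) = (?h - 0) * partial_deriv i F (x + z *\<^sub>R ?e)"
        by blast
      have "D m x = partial_deriv i F (x + z *\<^sub>R ?e)"
        using z by (simp add: D_def add.commute)
      then have b: "\<bar>D m x\<bar> \<le> B" using B by simp
      have "D m x = 0" if "x \<notin> cball 0 (R + 1)"
      proof -
        have n: "norm x > R + 1" using that by simp
        have "norm x \<le> norm (?h *\<^sub>R ?e + x) + norm (?h *\<^sub>R ?e)"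
          using norm_triangle_ineq4[of "?h *\<^sub>R ?e + x" "?h *\<^sub>R ?e"] by simp
        moreover have "norm (?h *\<^sub>R ?e) \<le> 1" by simp
        ultimately have "norm (?h *\<^sub>R ?e + x) > R" using n by linarith
        then have "?h *\<^sub>R ?e + x \<notin> K" "x \<notin> K" using R n by fastforce+
        then show ?thesis using K by (simp add: D_def)
      qed
      with b show "norm (D m x) \<le> B * indicator (cball 0 (R + 1)) x"
        by (auto split: split_indicator)
    qed
  qed auto
  ultimately show ?thesis by (simp add: LIMSEQ_const_iff)
qed

section \<open>Weak gradients\<close>

lemma L2_compact_support:
  fixes h :: "real ^ 'n \<Rightarrow> real"
  assumes "open \<Omega>" "continuous_on UNIV h" "compact K" "K \<subseteq> \<Omega>" "\<And>x. x \<notin> K \<Longrightarrow> h x = 0"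
  shows "h \<in> L2 \<Omega>"
proof -
  have [measurable]: "h \<in> borel_measurable borel" using assms(2) by (rule borel_measurable_continuous_onI)
  have "integrable lborel (\<lambda>x. (norm (h x))\<^sup>2)"
    using assms by (intro integrable_compact_support[of _ K] continuous_intros) auto
  then have "integrable (lebesgue_on \<Omega>) (\<lambda>x. (norm (h x))\<^sup>2)"
    by (subst lebesgue_on_eq_lborel(2)[OF assms(1)]) (use assms in auto)
  then show ?thesis unfolding L2_def by (auto intro: borel_measurable_on)
qed

lemma test_function_L2:
  assumes "open \<Omega>" "test_function \<Omega> \<psi>"
  shows "\<psi> \<in> L2 \<Omega>" "partial_deriv i \<psi> \<in> L2 \<Omega>"
  using assms(2) by (auto elim!: test_functionD intro: L2_compact_support[OF assms(1)])

text \<open>The product of two test functions has a continuous derivative supported in the compact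
  \<open>K\<close>, and that derivative integrates to zero.\<close>

lemma is_weak_gradient_test:
  assumes \<Omega>: "open \<Omega>" and \<psi>: "test_function \<Omega> \<psi>"
  shows "is_weak_gradient \<Omega> \<psi> (\<lambda>x. \<chi> i. partial_deriv i \<psi> x)"
  unfolding is_weak_gradient_def
proof (intro conjI allI impI)
  show "(\<lambda>x. \<chi> i. partial_deriv i \<psi> x) \<in> L2 \<Omega>"
    by (rule L2_vec_lambda) (rule test_function_L2[OF assms])
  fix \<eta> i assume \<eta>: "test_function \<Omega> \<eta>"
  obtain K where K: "compact K" "K \<subseteq> \<Omega>" "\<And>x. x \<notin> K \<Longrightarrow> \<psi> x = 0" "\<And>x i. x \<notin> K \<Longrightarrow> partial_deriv i \<psi> x = 0"
    "continuous_on UNIV \<psi>" "\<psi> differentiable_on UNIV" "\<And>i. continuous_on UNIV (partial_deriv i \<psi>)"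
    using test_functionD[OF \<psi>] by metis
  obtain L where L: "continuous_on UNIV \<eta>" "\<eta> differentiable_on UNIV" "\<And>i. continuous_on UNIV (partial_deriv i \<eta>)"
    using test_functionD[OF \<eta>] by metis
  have eq: "partial_deriv i (\<lambda>x. \<psi> x * \<eta> x) = (\<lambda>x. \<psi> x * partial_deriv i \<eta> x + partial_deriv i \<psi> x * \<eta> x)"
    by (rule partial_deriv_mult[OF K(6) L(2)])
  have int: "integral\<^sup>L lborel (partial_deriv i (\<lambda>x. \<psi> x * \<eta> x)) = 0"
  proof (rule integral_partial_deriv_zero[OF _ _ K(1)])
    show "(\<lambda>x. \<psi> x * \<eta> x) differentiable_on UNIV"
      using K(6) L(2) by (simp add: differentiable_on_mult)
    show "continuous_on UNIV (partial_deriv i (\<lambda>x. \<psi> x * \<eta> x))"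
      unfolding eq by (intro continuous_intros K L)
    show "x \<notin> K \<Longrightarrow> partial_deriv i (\<lambda>x. \<psi> x * \<eta> x) x = 0" for x
      unfolding eq by (simp add: K)
  qed (simp add: K)
  have i1: "integrable lborel (\<lambda>x. \<psi> x * partial_deriv i \<eta> x)"
    by (rule integrable_compact_support[OF _ K(1)]) (auto intro!: continuous_intros K L simp: K(3))
  have i2: "integrable lborel (\<lambda>x. partial_deriv i \<psi> x * \<eta> x)"
    by (rule integrable_compact_support[OF _ K(1)]) (auto intro!: continuous_intros K L simp: K(4))
  have "integral\<^sup>L lborel (\<lambda>x. \<psi> x * partial_deriv i \<eta> x) + integral\<^sup>L lborel (\<lambda>x. partial_deriv i \<psi> x * \<eta> x) = 0"
    using int unfolding eq using i1 i2 by simp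
  moreover have "integral\<^sup>L (lebesgue_on \<Omega>) (\<lambda>x. \<psi> x * partial_deriv i \<eta> x) = integral\<^sup>L lborel (\<lambda>x. \<psi> x * partial_deriv i \<eta> x)"
    by (rule lebesgue_on_eq_lborel[OF \<Omega> borel_measurable_integrable[OF i1, simplified]]) (use K in auto)
  moreover have "integral\<^sup>L (lebesgue_on \<Omega>) (\<lambda>x. partial_deriv i \<psi> x * \<eta> x) = integral\<^sup>L lborel (\<lambda>x. partial_deriv i \<psi> x * \<eta> x)"
    by (rule lebesgue_on_eq_lborel[OF \<Omega> borel_measurable_integrable[OF i2, simplified]]) (use K in auto)
  ultimately show "integral\<^sup>L (lebesgue_on \<Omega>) (\<lambda>x. \<psi> x * partial_deriv i \<eta> x) = - integral\<^sup>L (lebesgue_on \<Omega>) (\<lambda>x. (\<chi> i. partial_deriv i \<psi> x) $ i * \<eta> x)"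
    by simp
qed

lemma L2_mult_integrable:
  fixes u v :: "real ^ 'n \<Rightarrow> real"
  assumes "u \<in> L2 \<Omega>" "v \<in> L2 \<Omega>"
  shows "integrable (lebesgue_on \<Omega>) (\<lambda>x. u x * v x)"
  using L2_inner_integrable[OF assms] by simp

lemma is_weak_gradientD:
  assumes "is_weak_gradient \<Omega> v g"
  shows "g \<in> L2 \<Omega>" "test_function \<Omega> \<psi> \<Longrightarrow> integral\<^sup>L (lebesgue_on \<Omega>) (\<lambda>x. v x * partial_deriv i \<psi> x) =
             - integral\<^sup>L (lebesgue_on \<Omega>) (\<lambda>x. g x $ i * \<psi> x)"
  using assms by (auto simp: is_weak_gradient_def)

lemma is_weak_gradient_lincomb:
  assumes \<Omega>: "open \<Omega>" and L: "u \<in> L2 \<Omega>" "v \<in> L2 \<Omega>" 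
    and u: "is_weak_gradient \<Omega> u g" and v: "is_weak_gradient \<Omega> v h"
  shows "is_weak_gradient \<Omega> (\<lambda>x. a * u x + b * v x) (\<lambda>x. a *\<^sub>R g x + b *\<^sub>R h x)"
  unfolding is_weak_gradient_def
proof (intro conjI allI impI)
  show "(\<lambda>x. a *\<^sub>R g x + b *\<^sub>R h x) \<in> L2 \<Omega>"
    by (intro L2_add L2_scaleR is_weak_gradientD[OF u] is_weak_gradientD[OF v])
  fix \<psi> i assume \<psi>: "test_function \<Omega> \<psi>"
  have "integral\<^sup>L (lebesgue_on \<Omega>) (\<lambda>x. (a * u x + b * v x) * partial_deriv i \<psi> x) =
     integral\<^sup>L (lebesgue_on \<Omega>) (\<lambda>x. a * (u x * partial_deriv i \<psi> x) + b * (v x * partial_deriv i \<psi> x))"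
    by (simp add: algebra_simps)
  also have "\<dots> = a * integral\<^sup>L (lebesgue_on \<Omega>) (\<lambda>x. u x * partial_deriv i \<psi> x) + b * integral\<^sup>L (lebesgue_on \<Omega>) (\<lambda>x. v x * partial_deriv i \<psi> x)"
    using L2_mult_integrable[OF L(1) test_function_L2(2)[OF \<Omega> \<psi>]] L2_mult_integrable[OF L(2) test_function_L2(2)[OF \<Omega> \<psi>]]
    by simp
  also have "\<dots> = - (a * integral\<^sup>L (lebesgue_on \<Omega>) (\<lambda>x. g x $ i * \<psi> x) + b * integral\<^sup>L (lebesgue_on \<Omega>) (\<lambda>x. h x $ i * \<psi> x))"
    by (simp add: is_weak_gradientD(2)[OF u \<psi>] is_weak_gradientD(2)[OF v \<psi>])
  also have "a * integral\<^sup>L (lebesgue_on \<Omega>) (\<lambda>x. g x $ i * \<psi> x) + b * integral\<^sup>L (lebesgue_on \<Omega>) (\<lambda>x. h x $ i * \<psi> x) =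
     integral\<^sup>L (lebesgue_on \<Omega>) (\<lambda>x. a * (g x $ i * \<psi> x) + b * (h x $ i * \<psi> x))"
    using L2_mult_integrable[OF L2_vec_nth[OF is_weak_gradientD(1)[OF u]] test_function_L2(1)[OF \<Omega> \<psi>]] 
      L2_mult_integrable[OF L2_vec_nth[OF is_weak_gradientD(1)[OF v]] test_function_L2(1)[OF \<Omega> \<psi>]]
    by simp
  also have "\<dots> = integral\<^sup>L (lebesgue_on \<Omega>) (\<lambda>x. (a *\<^sub>R g x + b *\<^sub>R h x) $ i * \<psi> x)"
    by (simp add: algebra_simps)
  finally show "integral\<^sup>L (lebesgue_on \<Omega>) (\<lambda>x. (a * u x + b * v x) * partial_deriv i \<psi> x) =
    - integral\<^sup>L (lebesgue_on \<Omega>) (\<lambda>x. (a *\<^sub>R g x + b *\<^sub>R h x) $ i * \<psi> x)" .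
qed

text \<open>Square integrability is part of \<open>is_weak_gradient\<close>, so the fundamental
  lemma applies to each component of the difference.\<close>

lemma weak_gradient_unique:
  assumes \<Omega>: "open \<Omega>" and g: "is_weak_gradient \<Omega> v g" and h: "is_weak_gradient \<Omega> v h"
  shows "AE x in lebesgue_on \<Omega>. g x = h x"
proof -
  have "AE x in lebesgue_on \<Omega>. g x $ i - h x $ i = 0" for i
  proof (rule fundamental_lemma[OF \<Omega>])
    have L: "(\<lambda>x. g x $ i - h x $ i) \<in> L2 \<Omega>"
      by (intro L2_diff L2_vec_nth is_weak_gradientD[OF g] is_weak_gradientD[OF h])
    show "(\<lambda>x. g x $ i - h x $ i) \<in> borel_measurable (lebesgue_on \<Omega>)" 
      using L by (rule L2_measurable)
    show "integrable (lebesgue_on \<Omega>) (\<lambda>x. (g x $ i - h x $ i)\<^sup>2)" 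
      using L2_integrable[OF L] by simp
    fix \<psi> assume \<psi>: "test_function \<Omega> \<psi>"
    have "integral\<^sup>L (lebesgue_on \<Omega>) (\<lambda>x. (g x $ i - h x $ i) * \<psi> x) = 
       integral\<^sup>L (lebesgue_on \<Omega>) (\<lambda>x. g x $ i * \<psi> x) - integral\<^sup>L (lebesgue_on \<Omega>) (\<lambda>x. h x $ i * \<psi> x)"
      using L2_mult_integrable[OF L2_vec_nth[OF is_weak_gradientD(1)[OF g]] test_function_L2(1)[OF \<Omega> \<psi>]] 
        L2_mult_integrable[OF L2_vec_nth[OF is_weak_gradientD(1)[OF h]] test_function_L2(1)[OF \<Omega> \<psi>]]
      by (simp add: left_diff_distrib)
    also have "\<dots> = 0" using is_weak_gradientD(2)[OF g \<psi>, of i] is_weak_gradientD(2)[OF h \<psi>, of i] by simp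
    finally show "integral\<^sup>L (lebesgue_on \<Omega>) (\<lambda>x. (g x $ i - h x $ i) * \<psi> x) = 0" .
  qed
  then have "AE x in lebesgue_on \<Omega>. \<forall>i. g x $ i - h x $ i = 0"
    by (subst AE_all_countable) blast
  then show ?thesis by eventually_elim (simp add: vec_eq_iff)
qed

lemma is_weak_gradient_weak_gradient: "v \<in> H1 \<Omega> \<Longrightarrow> is_weak_gradient \<Omega> v (weak_gradient \<Omega> v)"
  unfolding weak_gradient_def by (rule someI_ex[of "is_weak_gradient \<Omega> v"]) (simp add: H1_def)

lemma H1_L2: "v \<in> H1 \<Omega> \<Longrightarrow> v \<in> L2 \<Omega>" by (simp add: H1_def)

lemma weak_gradient_L2: "v \<in> H1 \<Omega> \<Longrightarrow> weak_gradient \<Omega> v \<in> L2 \<Omega>"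
  using is_weak_gradient_weak_gradient is_weak_gradientD(1) by blast

text \<open>The three weak gradients are representatives chosen independently, so linearity is
  available only almost everywhere.\<close>

lemma weak_gradient_lincomb:
  assumes \<Omega>: "open \<Omega>" and u: "u \<in> H1 \<Omega>" and v: "v \<in> H1 \<Omega>" 
  shows "(\<lambda>x. a * u x + b * v x) \<in> H1 \<Omega>"
    "AE x in lebesgue_on \<Omega>. weak_gradient \<Omega> (\<lambda>x. a * u x + b * v x) x = a *\<^sub>R weak_gradient \<Omega> u x + b *\<^sub>R weak_gradient \<Omega> v x"
proof -
  note w = is_weak_gradient_lincomb[OF \<Omega> H1_L2[OF u] H1_L2[OF v] is_weak_gradient_weak_gradient[OF u] is_weak_gradient_weak_gradient[OF v], of a b]
  have "(\<lambda>x. a * u x + b * v x) \<in> L2 \<Omega>"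
    using L2_add[OF L2_scaleR[OF H1_L2[OF u], of a] L2_scaleR[OF H1_L2[OF v], of b]] by simp
  with w show *: "(\<lambda>x. a * u x + b * v x) \<in> H1 \<Omega>" by (auto simp: H1_def)
  show "AE x in lebesgue_on \<Omega>. weak_gradient \<Omega> (\<lambda>x. a * u x + b * v x) x = a *\<^sub>R weak_gradient \<Omega> u x + b *\<^sub>R weak_gradient \<Omega> v x"
    by (rule weak_gradient_unique[OF \<Omega> is_weak_gradient_weak_gradient[OF *] w])
qed

lemma weak_gradient_test:
  assumes \<Omega>: "open \<Omega>" and \<psi>: "test_function \<Omega> \<psi>"
  shows "\<psi> \<in> H1 \<Omega>" "AE x in lebesgue_on \<Omega>. weak_gradient \<Omega> \<psi> x = (\<chi> i. partial_deriv i \<psi> x)"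
proof -
  show *: "\<psi> \<in> H1 \<Omega>" using is_weak_gradient_test[OF assms] test_function_L2[OF assms] by (auto simp: H1_def)
  show "AE x in lebesgue_on \<Omega>. weak_gradient \<Omega> \<psi> x = (\<chi> i. partial_deriv i \<psi> x)"
    by (rule weak_gradient_unique[OF \<Omega> is_weak_gradient_weak_gradient[OF *] is_weak_gradient_test[OF assms]])
qed

section \<open>Ladyzhenskaya's inequality\<close>

text \<open>The fundamental theorem of calculus for the square of \<open>\<psi>\<close> along a
  coordinate line, started beyond the support. Since the integral runs over the whole line, the
  bound does not depend on \<open>a\<close>; this later separates the variables.\<close>

lemma square_le_line_integral:
  fixes \<psi> :: "real ^ 'n \<Rightarrow> real"
  assumes \<psi>: "test_function \<Omega> \<psi>"
  shows "ennreal ((\<psi> (x + a *\<^sub>R axis i 1))\<^sup>2) \<le>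
    (\<integral>\<^sup>+s. ennreal (2 * \<bar>\<psi> (x + s *\<^sub>R axis i 1)\<bar> * \<bar>partial_deriv i \<psi> (x + s *\<^sub>R axis i 1)\<bar>) \<partial>lborel)"
proof -
  obtain K where K: "compact K" "\<And>x. x \<notin> K \<Longrightarrow> \<psi> x = 0"
    "continuous_on UNIV \<psi>" "\<psi> differentiable_on UNIV" "\<And>i. continuous_on UNIV (partial_deriv i \<psi>)"
    using test_functionD[OF \<psi>] by metis
  obtain R where R: "\<And>x. x \<in> K \<Longrightarrow> norm x \<le> R" using compact_imp_bounded[OF K(1)] by (auto simp: bounded_iff)
  define q where "q s = x + s *\<^sub>R axis i (1::real)" for s
  have qc: "continuous_on UNIV q" unfolding q_def by (intro continuous_intros)
  \<comment> \<open>By the triangle inequality \<open>q s0\<close> lies outside the ball that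
    contains \<open>K\<close>; the minimum with \<open>a\<close> keeps the interval ordered.\<close>
  define s0 where "s0 = min a (- (\<bar>R\<bar> + norm x + 1))"
  have "norm (s0 *\<^sub>R axis i (1::real)) \<le> norm (q s0) + norm x"
    unfolding q_def using norm_triangle_ineq4[of "x + s0 *\<^sub>R axis i (1::real)" x] by simp
  then have "norm (q s0) > R" unfolding s0_def by (auto simp: min_def abs_if split: if_splits)
  then have q0: "\<psi> (q s0) = 0" using R K(2) by fastforce
  let ?F = "\<lambda>s. (\<psi> (q s))\<^sup>2" and ?f = "\<lambda>s. 2 * \<psi> (q s) * partial_deriv i \<psi> (q s)"
  have D: "(?F has_real_derivative ?f s) (at s)" for s
    using DERIV_along_axis[OF K(4), of x i s] unfolding q_def
    by (auto intro!: derivative_eq_intros simp: power2_eq_square)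
  have C: "isCont ?f s" for s
    using continuous_on_compose2[OF K(3) qc] continuous_on_compose2[OF K(5) qc]
    by (intro continuous_on_interior[of UNIV] continuous_intros) auto
  have B: "has_bochner_integral lborel (\<lambda>s. ?f s * indicator {s0..a} s) (?F a - ?F s0)"
    by (rule has_bochner_integral_FTC_Icc_real) (auto simp: s0_def intro: D C)
  have "ennreal (norm (?F a - ?F s0)) \<le> (\<integral>\<^sup>+s. norm (?f s * indicator {s0..a} s) \<partial>lborel)"
    using integral_norm_bound_ennreal[of lborel "\<lambda>s. ?f s * indicator {s0..a} s"] B
    by (simp add: has_bochner_integral_iff)
  also have "\<dots> \<le> (\<integral>\<^sup>+s. ennreal (2 * \<bar>\<psi> (q s)\<bar> * \<bar>partial_deriv i \<psi> (q s)\<bar>) \<partial>lborel)"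
    by (intro nn_integral_mono ennreal_leI) (auto simp: abs_mult split: split_indicator)
  finally show ?thesis using q0 by (simp add: q_def)
qed

section \<open>Fubini's theorem in two and three coordinates\<close>

interpretation lborel_prod_sigma: product_sigma_finite "\<lambda>_. lborel :: real measure"
  by standard

lemma nn_integral_lborel_2:
  fixes F :: "real ^ 'n \<Rightarrow> ennreal"
  assumes "UNIV = {i, j :: 'n}" "i \<noteq> j" and [measurable]: "F \<in> borel_measurable borel"
  shows "integral\<^sup>N lborel F = (\<integral>\<^sup>+z. F (fst z *\<^sub>R axis i 1 + snd z *\<^sub>R axis j 1) \<partial>(lborel \<Otimes>\<^sub>M lborel))"
proof -
  have Basis: "(Basis :: (real^'n) set) = {axis i 1, axis j 1}"
    unfolding Basis_vec_def using assms(1) by auto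
  have ne: "axis i (1::real) \<noteq> axis j 1" using assms(2) by (simp add: axis_eq_axis)
  have "integral\<^sup>N lborel F = (\<integral>\<^sup>+f. F (f (axis i 1) *\<^sub>R axis i 1 + f (axis j 1) *\<^sub>R axis j 1) \<partial>(\<Pi>\<^sub>M b\<in>{axis i (1::real), axis j 1}. lborel))"
    by (subst lborel_eq, subst nn_integral_distr) (auto simp: Basis ne)
  also have "\<dots> = (\<integral>\<^sup>+z. F (fst z *\<^sub>R axis i 1 + snd z *\<^sub>R axis j 1) \<partial>(lborel \<Otimes>\<^sub>M lborel))"
    by (rule lborel_prod_sigma.product_nn_integral_pair[where f="\<lambda>a b. F (a *\<^sub>R axis i 1 + b *\<^sub>R axis j 1)"]) (auto simp: ne)
  finally show ?thesis .
qed

text \<open>The direction \<open>k\<close> is integrated last, which leaves planar slices for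
  \<open>slice_product_bound\<close>.\<close>

lemma nn_integral_lborel_3:
  fixes F :: "real ^ 'n \<Rightarrow> ennreal"
  assumes "UNIV = {i, j, k :: 'n}" "i \<noteq> j" "i \<noteq> k" "j \<noteq> k" and [measurable]: "F \<in> borel_measurable borel"
  shows "integral\<^sup>N lborel F = (\<integral>\<^sup>+c. \<integral>\<^sup>+z. F (fst z *\<^sub>R axis i 1 + snd z *\<^sub>R axis j 1 + c *\<^sub>R axis k 1) \<partial>(lborel \<Otimes>\<^sub>M lborel) \<partial>lborel)"
proof -
  have Basis: "(Basis :: (real^'n) set) = {axis k 1, axis i 1, axis j 1}"
    unfolding Basis_vec_def using assms(1) by auto
  have ne: "axis i (1::real) \<noteq> axis j 1" "axis k (1::real) \<noteq> axis j 1" "axis k (1::real) \<noteq> axis i 1" 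
    using assms by (auto simp: axis_eq_axis)
  have "integral\<^sup>N lborel F = (\<integral>\<^sup>+f. F (f (axis i 1) *\<^sub>R axis i 1 + f (axis j 1) *\<^sub>R axis j 1 + f (axis k 1) *\<^sub>R axis k 1) \<partial>(\<Pi>\<^sub>M b\<in>{axis k (1::real), axis i 1, axis j 1}. lborel))"
    by (subst lborel_eq, subst nn_integral_distr) (auto simp: Basis ne algebra_simps)
  also have "\<dots> = (\<integral>\<^sup>+c. \<integral>\<^sup>+f. F (f (axis i 1) *\<^sub>R axis i 1 + f (axis j 1) *\<^sub>R axis j 1 + c *\<^sub>R axis k 1) \<partial>(\<Pi>\<^sub>M b\<in>{axis i (1::real), axis j 1}. lborel) \<partial>lborel)"
    by (subst lborel_prod_sigma.product_nn_integral_insert_rev) (auto simp: ne ne[symmetric])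
  also have "\<dots> = (\<integral>\<^sup>+c. \<integral>\<^sup>+z. F (fst z *\<^sub>R axis i 1 + snd z *\<^sub>R axis j 1 + c *\<^sub>R axis k 1) \<partial>(lborel \<Otimes>\<^sub>M lborel) \<partial>lborel)"
    by (intro nn_integral_cong lborel_prod_sigma.product_nn_integral_pair[where f="\<lambda>a b. F (a *\<^sub>R axis i 1 + b *\<^sub>R axis j 1 + _ *\<^sub>R axis k 1)"]) (auto simp: ne)
  finally show ?thesis .
qed

text \<open>The first bound depends only on b and the second only on a, so their product majorizes
  G^2 and its double integral factorizes.\<close>

lemma slice_product_bound:
  fixes G H1 H2 :: "real \<times> real \<Rightarrow> ennreal"
  assumes [measurable]: "H1 \<in> borel_measurable (lborel \<Otimes>\<^sub>M lborel)" "H2 \<in> borel_measurable (lborel \<Otimes>\<^sub>M lborel)"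
    and 1: "\<And>a b. G (a, b) \<le> (\<integral>\<^sup>+s. H1 (s, b) \<partial>lborel)"
    and 2: "\<And>a b. G (a, b) \<le> (\<integral>\<^sup>+t. H2 (a, t) \<partial>lborel)"
  shows "(\<integral>\<^sup>+z. (G z)\<^sup>2 \<partial>(lborel \<Otimes>\<^sub>M lborel)) \<le> (\<integral>\<^sup>+z. H1 z \<partial>(lborel \<Otimes>\<^sub>M lborel)) * (\<integral>\<^sup>+z. H2 z \<partial>(lborel \<Otimes>\<^sub>M lborel))"
proof -
  define P Q where "P b = (\<integral>\<^sup>+s. H1 (s, b) \<partial>lborel)" and "Q a = (\<integral>\<^sup>+t. H2 (a, t) \<partial>lborel)" for a b
  have [measurable]: "P \<in> borel_measurable lborel" "Q \<in> borel_measurable lborel" unfolding P_def Q_def by measurable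
  have "(\<integral>\<^sup>+z. (G z)\<^sup>2 \<partial>(lborel \<Otimes>\<^sub>M lborel)) \<le> (\<integral>\<^sup>+z. P (snd z) * Q (fst z) \<partial>(lborel \<Otimes>\<^sub>M lborel))"
    unfolding power2_eq_square P_def Q_def
    by (intro nn_integral_mono mult_mono) (auto intro!: 1 2 simp: split_beta)
  also have "\<dots> = (\<integral>\<^sup>+a. \<integral>\<^sup>+b. P b * Q a \<partial>lborel \<partial>lborel)"
    by (subst lborel.nn_integral_fst[symmetric]) auto
  also have "\<dots> = integral\<^sup>N lborel P * integral\<^sup>N lborel Q"
    by (simp add: nn_integral_multc nn_integral_cmult)
  also have "integral\<^sup>N lborel P = (\<integral>\<^sup>+z. H1 z \<partial>(lborel \<Otimes>\<^sub>M lborel))"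
    unfolding P_def by (subst lborel_pair.nn_integral_snd[symmetric]) auto
  also have "integral\<^sup>N lborel Q = (\<integral>\<^sup>+z. H2 z \<partial>(lborel \<Otimes>\<^sub>M lborel))"
    unfolding Q_def by (subst lborel.nn_integral_fst[symmetric]) auto
  finally show ?thesis .
qed

text \<open>Stands in for square roots in \<open>ennreal\<close>: the product is at most the square
  of the larger factor.\<close>

lemma mult_le_of_squares_le:
  fixes a b X :: ennreal
  assumes "a\<^sup>2 \<le> X" "b\<^sup>2 \<le> X"
  shows "a * b \<le> X"
proof (cases "a \<le> b")
  case True
  then have "a * b \<le> b * b" by (intro mult_right_mono) auto
  with assms show ?thesis by (simp add: power2_eq_square)
next
  case False
  then have "a * b \<le> a * a" by (intro mult_left_mono) auto
  with assms show ?thesis by (simp add: power2_eq_square)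
qed

text \<open>The integrand of the squared H^1 norm, written with classical derivatives.\<close>

definition energy_density :: "(real ^ 'n \<Rightarrow> real) \<Rightarrow> real ^ 'n \<Rightarrow> real" where
  "energy_density \<psi> x = (\<psi> x)\<^sup>2 + (\<Sum>i\<in>UNIV. (partial_deriv i \<psi> x)\<^sup>2)"

lemma partial_deriv_le_sum: "(partial_deriv i \<psi> x)\<^sup>2 \<le> (\<Sum>i\<in>UNIV. (partial_deriv i \<psi> x)\<^sup>2)"
  by (rule member_le_sum) auto

lemma young_energy: "2 * \<bar>\<psi> x\<bar> * \<bar>partial_deriv i \<psi> x\<bar> \<le> energy_density \<psi> x"
  using sum_squares_bound[of "\<bar>\<psi> x\<bar>" "\<bar>partial_deriv i \<psi> x\<bar>"] partial_deriv_le_sum[of i \<psi> x]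
  by (simp add: energy_density_def)

text \<open>One factor of \<psi>^4 = \<psi>^2 \<psi>^2 is bounded by a line integral in the
  direction \<open>i\<close>, the other by one in the direction \<open>j\<close>. Each of the two
  resulting plane integrals is at most the energy, by Young's inequality.\<close>

lemma ladyzhenskaya_2:
  fixes \<psi> :: "real ^ 'n \<Rightarrow> real"
  assumes \<psi>: "test_function \<Omega> \<psi>" and ij: "UNIV = {i, j :: 'n}" "i \<noteq> j"
  shows "(\<integral>\<^sup>+x. ennreal (\<psi> x ^ 4) \<partial>lborel) \<le> (\<integral>\<^sup>+x. ennreal (energy_density \<psi> x) \<partial>lborel)\<^sup>2"
proof -
  obtain K where c: "continuous_on UNIV \<psi>" "\<And>i. continuous_on UNIV (partial_deriv i \<psi>)"
    using test_functionD[OF \<psi>] by metis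
  have [measurable]: "\<psi> \<in> borel_measurable borel" "partial_deriv i \<psi> \<in> borel_measurable borel" for i
    using c by (auto intro: borel_measurable_continuous_onI)
  have [measurable]: "energy_density \<psi> \<in> borel_measurable borel" unfolding energy_density_def[abs_def] by measurable
  let ?E = "\<integral>\<^sup>+x. ennreal (energy_density \<psi> x) \<partial>lborel"
  let ?q = "\<lambda>z::real \<times> real. fst z *\<^sub>R axis i 1 + snd z *\<^sub>R axis j (1::real) :: real ^ 'n"
  let ?h = "\<lambda>l x. ennreal (2 * \<bar>\<psi> x\<bar> * \<bar>partial_deriv l \<psi> x\<bar>)"
  have H: "(\<integral>\<^sup>+z. ?h l (?q z) \<partial>(lborel \<Otimes>\<^sub>M lborel)) \<le> ?E" for l
    by (subst nn_integral_lborel_2[OF ij, symmetric]) (auto intro!: nn_integral_mono ennreal_leI young_energy)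
  have "(\<integral>\<^sup>+x. ennreal (\<psi> x ^ 4) \<partial>lborel) = (\<integral>\<^sup>+z. (ennreal ((\<psi> (?q z))\<^sup>2))\<^sup>2 \<partial>(lborel \<Otimes>\<^sub>M lborel))"
    by (subst nn_integral_lborel_2[OF ij]) (auto simp: ennreal_power)
  also have "\<dots> \<le> (\<integral>\<^sup>+z. ?h i (?q z) \<partial>(lborel \<Otimes>\<^sub>M lborel)) * (\<integral>\<^sup>+z. ?h j (?q z) \<partial>(lborel \<Otimes>\<^sub>M lborel))"
  proof (rule slice_product_bound)
    fix a b
    show "ennreal ((\<psi> (?q (a, b)))\<^sup>2) \<le> (\<integral>\<^sup>+s. ?h i (?q (s, b)) \<partial>lborel)"
      using square_le_line_integral[OF \<psi>, of "b *\<^sub>R axis j 1" a i] by (simp add: add.commute)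
    show "ennreal ((\<psi> (?q (a, b)))\<^sup>2) \<le> (\<integral>\<^sup>+t. ?h j (?q (a, t)) \<partial>lborel)"
      using square_le_line_integral[OF \<psi>, of "a *\<^sub>R axis i 1" b j] by simp
  qed auto
  also have "\<dots> \<le> ?E\<^sup>2" unfolding power2_eq_square by (intro mult_mono H) auto
  finally show ?thesis .
qed

text \<open>On the slice with k-th coordinate c the planar argument gives a product of two integrals
  of the form \<open>?h\<close>. Cauchy-Schwarz bounds the square of each by 4 m(c) d(c), whence the
  constant 4. Since m(c) is at most the total energy for every c, only d(c) remains to be integrated
  over c.\<close>

lemma ladyzhenskaya_3:
  fixes \<psi> :: "real ^ 'n \<Rightarrow> real"
  assumes \<psi>: "test_function \<Omega> \<psi>" and ijk: "UNIV = {i, j, k :: 'n}" "i \<noteq> j" "i \<noteq> k" "j \<noteq> k"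
  shows "(\<integral>\<^sup>+x. ennreal (\<psi> x ^ 4) \<partial>lborel) \<le> 4 * (\<integral>\<^sup>+x. ennreal (energy_density \<psi> x) \<partial>lborel)\<^sup>2"
proof -
  obtain K where c: "continuous_on UNIV \<psi>" "\<And>i. continuous_on UNIV (partial_deriv i \<psi>)"
    using test_functionD[OF \<psi>] by metis
  have [measurable]: "\<psi> \<in> borel_measurable borel" "partial_deriv i \<psi> \<in> borel_measurable borel" for i
    using c by (auto intro: borel_measurable_continuous_onI)
  have [measurable]: "energy_density \<psi> \<in> borel_measurable borel" unfolding energy_density_def[abs_def] by measurable
  let ?E = "\<integral>\<^sup>+x. ennreal (energy_density \<psi> x) \<partial>lborel"
  let ?q = "\<lambda>c (z::real \<times> real). fst z *\<^sub>R axis i 1 + snd z *\<^sub>R axis j 1 + c *\<^sub>R axis k (1::real) :: real ^ 'n"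
  let ?h = "\<lambda>l x. ennreal (2 * \<bar>\<psi> x\<bar> * \<bar>partial_deriv l \<psi> x\<bar>)"
  let ?P = "lborel \<Otimes>\<^sub>M lborel :: (real \<times> real) measure"
  define m where "m c = (\<integral>\<^sup>+z. ennreal ((\<psi> (?q c z))\<^sup>2) \<partial>?P)" for c
  define d where "d c = (\<integral>\<^sup>+z. ennreal (energy_density \<psi> (?q c z)) \<partial>?P)" for c
  have [measurable]: "d \<in> borel_measurable borel" unfolding d_def by measurable
  \<comment> \<open>The slice mass is controlled uniformly in c by line integrals in the direction
    \<open>k\<close>, which Fubini's theorem turns into a volume integral.\<close>
  have m: "m c \<le> ?E" for c
  proof -
    have "m c \<le> (\<integral>\<^sup>+z. \<integral>\<^sup>+s. ?h k (?q s z) \<partial>lborel \<partial>?P)"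
      unfolding m_def by (intro nn_integral_mono square_le_line_integral[OF \<psi>])
    also have "\<dots> = (\<integral>\<^sup>+s. \<integral>\<^sup>+z. ?h k (?q s z) \<partial>?P \<partial>lborel)"
    proof -
      have "(\<lambda>p. ?q (fst p) (snd p)) \<in> borel_measurable borel"
        by (intro borel_measurable_continuous_onI continuous_intros)
      then have "(\<lambda>p. ?h k (?q (fst p) (snd p))) \<in> borel_measurable borel"
        by (rule measurable_compose[where g="?h k"]) measurable
      then have "case_prod (\<lambda>s z. ?h k (?q s z)) \<in> borel_measurable (lborel \<Otimes>\<^sub>M lborel)"
        unfolding lborel_prod by (simp add: split_beta')
      note F = lborel_pair.Fubini'[OF this]
      show ?thesis unfolding lborel_prod by (rule F)
    qed
    also have "\<dots> = (\<integral>\<^sup>+x. ?h k x \<partial>lborel)"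
      by (subst nn_integral_lborel_3[OF ijk]) auto
    also have "\<dots> \<le> ?E" by (intro nn_integral_mono ennreal_leI young_energy)
    finally show ?thesis .
  qed
  have A: "(\<integral>\<^sup>+z. ?h l (?q c z) \<partial>?P)\<^sup>2 \<le> 4 * m c * d c" for l c
  proof -
    have "(\<integral>\<^sup>+z. ?h l (?q c z) \<partial>?P)\<^sup>2 = (\<integral>\<^sup>+z. ennreal (2 * \<bar>\<psi> (?q c z)\<bar>) * ennreal \<bar>partial_deriv l \<psi> (?q c z)\<bar> \<partial>?P)\<^sup>2"
      by (simp add: ennreal_mult)
    also have "\<dots> \<le> (\<integral>\<^sup>+z. (ennreal (2 * \<bar>\<psi> (?q c z)\<bar>))\<^sup>2 \<partial>?P) * (\<integral>\<^sup>+z. (ennreal \<bar>partial_deriv l \<psi> (?q c z)\<bar>)\<^sup>2 \<partial>?P)"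
      by (rule Cauchy_Schwarz_nn_integral) measurable
    also have "(\<integral>\<^sup>+z. (ennreal (2 * \<bar>\<psi> (?q c z)\<bar>))\<^sup>2 \<partial>?P) = 4 * m c"
      unfolding m_def by (subst nn_integral_cmult[symmetric])
        (auto simp: ennreal_power power_mult_distrib ennreal_mult intro!: nn_integral_cong)
    also have "(\<integral>\<^sup>+z. (ennreal \<bar>partial_deriv l \<psi> (?q c z)\<bar>)\<^sup>2 \<partial>?P) \<le> d c"
      unfolding d_def
    proof (rule nn_integral_mono)
      fix z
      have "(partial_deriv l \<psi> (?q c z))\<^sup>2 \<le> energy_density \<psi> (?q c z)"
        using partial_deriv_le_sum[of l \<psi> "?q c z"] by (simp add: energy_density_def add_increasing)
      then show "(ennreal \<bar>partial_deriv l \<psi> (?q c z)\<bar>)\<^sup>2 \<le> ennreal (energy_density \<psi> (?q c z))"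
        by (simp add: ennreal_power ennreal_leI)
    qed
    finally show ?thesis by (simp add: mult_left_mono)
  qed
  have "(\<integral>\<^sup>+x. ennreal (\<psi> x ^ 4) \<partial>lborel) = (\<integral>\<^sup>+c. \<integral>\<^sup>+z. (ennreal ((\<psi> (?q c z))\<^sup>2))\<^sup>2 \<partial>?P \<partial>lborel)"
    by (subst nn_integral_lborel_3[OF ijk]) (auto simp: ennreal_power)
  also have "\<dots> \<le> (\<integral>\<^sup>+c. 4 * ?E * d c \<partial>lborel)"
  proof (rule nn_integral_mono)
    fix c
    have "(\<integral>\<^sup>+z. (ennreal ((\<psi> (?q c z))\<^sup>2))\<^sup>2 \<partial>?P) \<le> (\<integral>\<^sup>+z. ?h i (?q c z) \<partial>?P) * (\<integral>\<^sup>+z. ?h j (?q c z) \<partial>?P)"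
    proof (rule slice_product_bound)
      fix a b
      show "ennreal ((\<psi> (?q c (a, b)))\<^sup>2) \<le> (\<integral>\<^sup>+s. ?h i (?q c (s, b)) \<partial>lborel)"
        using square_le_line_integral[OF \<psi>, of "b *\<^sub>R axis j 1 + c *\<^sub>R axis k 1" a i] by (simp add: algebra_simps)
      show "ennreal ((\<psi> (?q c (a, b)))\<^sup>2) \<le> (\<integral>\<^sup>+t. ?h j (?q c (a, t)) \<partial>lborel)"
        using square_le_line_integral[OF \<psi>, of "a *\<^sub>R axis i 1 + c *\<^sub>R axis k 1" b j] by (simp add: algebra_simps)
    qed auto
    also have "\<dots> \<le> 4 * m c * d c" by (rule mult_le_of_squares_le[OF A A])
    also have "\<dots> \<le> 4 * ?E * d c" by (intro mult_right_mono mult_left_mono m) auto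
    finally show "(\<integral>\<^sup>+z. (ennreal ((\<psi> (?q c z))\<^sup>2))\<^sup>2 \<partial>?P) \<le> 4 * ?E * d c" .
  qed
  also have "\<dots> = 4 * ?E * integral\<^sup>N lborel d" by (rule nn_integral_cmult) measurable
  also have "integral\<^sup>N lborel d = ?E"
    unfolding d_def by (subst nn_integral_lborel_3[OF ijk]) auto
  finally show ?thesis by (simp add: power2_eq_square mult.assoc)
qed

lemma ladyzhenskaya:
  fixes \<psi> :: "real ^ 'n \<Rightarrow> real"
  assumes \<psi>: "test_function \<Omega> \<psi>" and dim: "CARD('n) = 2 \<or> CARD('n) = 3"
  shows "(\<integral>\<^sup>+x. ennreal (\<psi> x ^ 4) \<partial>lborel) \<le> 4 * (\<integral>\<^sup>+x. ennreal (energy_density \<psi> x) \<partial>lborel)\<^sup>2"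
  using dim
proof
  assume "CARD('n) = 2"
  then obtain i j :: 'n where "UNIV = {i, j}" "i \<noteq> j" by (auto simp: card_2_iff)
  from ladyzhenskaya_2[OF \<psi> this] 
  have "(\<integral>\<^sup>+x. ennreal (\<psi> x ^ 4) \<partial>lborel) \<le> 1 * (\<integral>\<^sup>+x. ennreal (energy_density \<psi> x) \<partial>lborel)\<^sup>2" by simp
  also have "\<dots> \<le> 4 * (\<integral>\<^sup>+x. ennreal (energy_density \<psi> x) \<partial>lborel)\<^sup>2" by (intro mult_right_mono) auto
  finally show ?thesis .
next
  assume "CARD('n) = 3"
  then obtain i j k :: 'n where "UNIV = {i, j, k}" "i \<noteq> j" "i \<noteq> k" "j \<noteq> k" by (auto simp: card_3_iff)
  from ladyzhenskaya_3[OF \<psi> this] show ?thesis .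
qed

section \<open>Embedding of \<open>H\<^sup>1\<^sub>0\<close> into \<open>L\<^sup>4\<close>\<close>

lemma H1_norm_square: "(H1_norm \<Omega> v)\<^sup>2 = (L2_norm \<Omega> v)\<^sup>2 + (L2_norm \<Omega> (weak_gradient \<Omega> v))\<^sup>2"
  by (simp add: H1_norm_def)

text \<open>Links the classical density to \<open>H1_norm\<close>, whose weak gradient agrees with
  the classical one only almost everywhere.\<close>

lemma nn_integral_energy_density:
  assumes \<Omega>: "open \<Omega>" and \<psi>: "test_function \<Omega> \<psi>"
  shows "(\<integral>\<^sup>+x. ennreal (energy_density \<psi> x) \<partial>lborel) = ennreal ((H1_norm \<Omega> \<psi>)\<^sup>2)"
proof -
  obtain K where K: "compact K" "K \<subseteq> \<Omega>" "\<And>x. x \<notin> K \<Longrightarrow> \<psi> x = 0" "\<And>x i. x \<notin> K \<Longrightarrow> partial_deriv i \<psi> x = 0"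
    "continuous_on UNIV \<psi>" "\<And>i. continuous_on UNIV (partial_deriv i \<psi>)"
    using test_functionD[OF \<psi>] by metis
  let ?g = "\<lambda>x. \<chi> i. partial_deriv i \<psi> x"
  have g: "?g \<in> L2 \<Omega>" using is_weak_gradient_test[OF \<Omega> \<psi>] is_weak_gradientD(1) by blast
  have c: "continuous_on UNIV (energy_density \<psi>)" unfolding energy_density_def[abs_def] by (intro continuous_intros K)
  have z: "x \<notin> K \<Longrightarrow> energy_density \<psi> x = 0" for x by (simp add: energy_density_def K)
  have e: "energy_density \<psi> = (\<lambda>x. \<psi> x \<bullet> \<psi> x + ?g x \<bullet> ?g x)"
    by (simp add: fun_eq_iff energy_density_def inner_vec_def power2_eq_square)
  have "(\<integral>\<^sup>+x. ennreal (energy_density \<psi> x) \<partial>lborel) = ennreal (integral\<^sup>L lborel (energy_density \<psi>))"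
    using integrable_compact_support[OF c K(1) z] 
    by (intro nn_integral_eq_integral) (auto simp: energy_density_def sum_nonneg)
  also have "integral\<^sup>L lborel (energy_density \<psi>) = integral\<^sup>L (lebesgue_on \<Omega>) (energy_density \<psi>)"
    by (rule lebesgue_on_eq_lborel(1)[OF \<Omega> borel_measurable_continuous_onI[OF c], symmetric]) (use z K in auto)
  also have "\<dots> = L2_inner \<Omega> \<psi> \<psi> + L2_inner \<Omega> ?g ?g"
    unfolding e L2_inner_def
    by (intro Bochner_Integration.integral_add L2_inner_integrable g test_function_L2[OF \<Omega> \<psi>])
  also have "L2_inner \<Omega> ?g ?g = L2_inner \<Omega> (weak_gradient \<Omega> \<psi>) (weak_gradient \<Omega> \<psi>)"
    using weak_gradient_test[OF \<Omega> \<psi>] g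
    by (intro L2_inner_cong_AE) (auto intro: weak_gradient_L2 elim: AE_mp)
  finally show ?thesis by (simp add: H1_norm_square L2_norm_square)
qed

text \<open>The approximating test functions are bounded in H^1, hence in L^4. They converge to
  \<open>v\<close> only in norm, so Fatou's lemma is applied along a subsequence that converges
  almost everywhere.\<close>

lemma H10_L4:
  fixes v :: "real ^ 'n \<Rightarrow> real"
  assumes dim: "CARD('n) = 2 \<or> CARD('n) = 3" and \<Omega>: "open \<Omega>" and v: "v \<in> H10 \<Omega>"
  shows "integrable (lebesgue_on \<Omega>) (\<lambda>x. v x ^ 4)"
proof -
  let ?M = "lebesgue_on \<Omega>"
  obtain \<psi> where \<psi>: "\<And>k::nat. test_function \<Omega> (\<psi> k)" 
    and lim: "(\<lambda>k. H1_norm \<Omega> (\<lambda>x. \<psi> k x - v x)) \<longlonglongrightarrow> 0"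
    using v by (auto simp: H10_def)
  have vH: "v \<in> H1 \<Omega>" using v by (simp add: H10_def)
  have \<psi>H: "\<psi> k \<in> H1 \<Omega>" for k by (rule weak_gradient_test[OF \<Omega> \<psi>])
  have dH: "(\<lambda>x. \<psi> k x - v x) \<in> H1 \<Omega>" 
    and dg: "AE x in ?M. weak_gradient \<Omega> (\<lambda>x. \<psi> k x - v x) x = weak_gradient \<Omega> (\<psi> k) x - weak_gradient \<Omega> v x" for k
    using weak_gradient_lincomb[OF \<Omega> \<psi>H[of k] vH, of 1 "-1"] by simp_all
  note [measurable] = L2_measurable[OF H1_L2[OF vH]] L2_measurable[OF H1_L2[OF \<psi>H]]
  \<comment> \<open>From |a + b|^2 \<le> 2 |a|^2 + 2 |b|^2 with a = \<psi> k - v and b = v, for the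
    functions and for their gradients.\<close>
  have bound: "(H1_norm \<Omega> (\<psi> k))\<^sup>2 \<le> 2 * (H1_norm \<Omega> (\<lambda>x. \<psi> k x - v x))\<^sup>2 + 2 * (H1_norm \<Omega> v)\<^sup>2" for k
  proof -
    have "(L2_norm \<Omega> (\<psi> k))\<^sup>2 \<le> 2 * (L2_norm \<Omega> (\<lambda>x. \<psi> k x - v x))\<^sup>2 + 2 * (L2_norm \<Omega> v)\<^sup>2"
      using L2_norm_add_square[OF H1_L2[OF dH[of k]] H1_L2[OF vH]] by simp
    moreover have "(L2_norm \<Omega> (weak_gradient \<Omega> (\<psi> k)))\<^sup>2 \<le> 
      2 * (L2_norm \<Omega> (weak_gradient \<Omega> (\<lambda>x. \<psi> k x - v x)))\<^sup>2 + 2 * (L2_norm \<Omega> (weak_gradient \<Omega> v))\<^sup>2"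
    proof -
      let ?w = "\<lambda>x. weak_gradient \<Omega> (\<lambda>x. \<psi> k x - v x) x + weak_gradient \<Omega> v x"
      have "AE x in ?M. weak_gradient \<Omega> (\<psi> k) x = ?w x" using dg[of k] by eventually_elim simp
      then have "(L2_norm \<Omega> (weak_gradient \<Omega> (\<psi> k)))\<^sup>2 = (L2_norm \<Omega> ?w)\<^sup>2"
        unfolding L2_norm_square by (intro L2_inner_cong_AE weak_gradient_L2 \<psi>H L2_add dH vH)
      then show ?thesis using L2_norm_add_square[OF weak_gradient_L2[OF dH[of k]] weak_gradient_L2[OF vH]] by simp
    qed
    ultimately show ?thesis by (simp add: H1_norm_square)
  qed
  obtain B where B: "\<And>k. \<bar>H1_norm \<Omega> (\<lambda>x. \<psi> k x - v x)\<bar> \<le> B"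
    using convergent_imp_Bseq[OF convergentI[OF lim]] by (auto simp: Bseq_def)
  define C where "C = 2 * B\<^sup>2 + 2 * (H1_norm \<Omega> v)\<^sup>2"
  have C: "(H1_norm \<Omega> (\<psi> k))\<^sup>2 \<le> C" for k
    using bound[of k] power_mono[OF B, of k 2] by (simp add: C_def)
  have L4: "(\<integral>\<^sup>+x. ennreal (\<psi> k x ^ 4) \<partial>?M) \<le> 4 * (ennreal C)\<^sup>2" for k
  proof -
    have "(\<integral>\<^sup>+x. ennreal (\<psi> k x ^ 4) \<partial>?M) = (\<integral>\<^sup>+x. ennreal (\<psi> k x ^ 4) * indicator \<Omega> x \<partial>lebesgue)"
      by (rule nn_integral_restrict_space) (use \<Omega> in auto)
    also have "\<dots> \<le> (\<integral>\<^sup>+x. ennreal (\<psi> k x ^ 4) \<partial>lborel)"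
      unfolding nn_integral_completion by (intro nn_integral_mono) (auto split: split_indicator)
    also have "\<dots> \<le> 4 * (ennreal ((H1_norm \<Omega> (\<psi> k))\<^sup>2))\<^sup>2"
      using ladyzhenskaya[OF \<psi> dim, of k] by (simp add: nn_integral_energy_density[OF \<Omega> \<psi>])
    also have "\<dots> \<le> 4 * (ennreal C)\<^sup>2"
      by (intro mult_left_mono power_mono ennreal_leI C) auto
    finally show ?thesis .
  qed
  \<comment> \<open>Convergence in L^2 is convergence of the squared differences in L^1, which
    yields the subsequence.\<close>
  have "\<exists>r::nat\<Rightarrow>nat. strict_mono r \<and> (AE x in ?M. (\<lambda>n. (\<psi> (r n) x - v x)\<^sup>2) \<longlonglongrightarrow> 0)"
  proof (rule tendsto_L1_AE_subseq)
    show "integrable ?M (\<lambda>x. (\<psi> n x - v x)\<^sup>2)" for n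
      using L2_integrable[OF H1_L2[OF dH]] by simp
    have 1: "(\<lambda>k. (H1_norm \<Omega> (\<lambda>x. \<psi> k x - v x))\<^sup>2) \<longlonglongrightarrow> 0"
      using tendsto_power[OF lim, of 2] by simp
    have 2: "norm (integral\<^sup>L ?M (\<lambda>x. norm ((\<psi> n x - v x)\<^sup>2))) \<le> (H1_norm \<Omega> (\<lambda>x. \<psi> n x - v x))\<^sup>2" for n
      by (simp add: H1_norm_square L2_norm_square L2_inner_def flip: power2_eq_square)
    show "(\<lambda>n. integral\<^sup>L ?M (\<lambda>x. norm ((\<psi> n x - v x)\<^sup>2))) \<longlonglongrightarrow> 0"
      by (rule Lim_null_comparison[OF always_eventually[OF allI[OF 2]] 1])
  qed
  then obtain r where r: "strict_mono r" and ae: "AE x in ?M. (\<lambda>n. (\<psi> (r n) x - v x)\<^sup>2) \<longlonglongrightarrow> 0" by auto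
  have "AE x in ?M. ennreal (v x ^ 4) = liminf (\<lambda>n. ennreal (\<psi> (r n) x ^ 4))"
    using ae
  proof eventually_elim
    case (elim x)
    then have "(\<lambda>n. sqrt ((\<psi> (r n) x - v x)\<^sup>2)) \<longlonglongrightarrow> sqrt 0" by (intro tendsto_real_sqrt)
    then have "(\<lambda>n. \<psi> (r n) x) \<longlonglongrightarrow> v x" by (simp add: tendsto_rabs_zero_iff LIM_zero_iff)
    then have "(\<lambda>n. ennreal (\<psi> (r n) x ^ 4)) \<longlonglongrightarrow> ennreal (v x ^ 4)" by (intro tendsto_ennrealI tendsto_power)
    then show ?case by (rule lim_imp_Liminf[OF sequentially_bot, symmetric])
  qed
  then have "(\<integral>\<^sup>+x. ennreal (v x ^ 4) \<partial>?M) = (\<integral>\<^sup>+x. liminf (\<lambda>n. ennreal (\<psi> (r n) x ^ 4)) \<partial>?M)"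
    by (rule nn_integral_cong_AE)
  also have "\<dots> \<le> liminf (\<lambda>n. \<integral>\<^sup>+x. ennreal (\<psi> (r n) x ^ 4) \<partial>?M)"
    by (rule nn_integral_liminf) measurable
  also have "\<dots> \<le> 4 * (ennreal C)\<^sup>2"
    using Liminf_le[of sequentially "\<lambda>n. \<integral>\<^sup>+x. ennreal (\<psi> (r n) x ^ 4) \<partial>?M"] L4 by (simp add: Liminf_bounded)
  also have "\<dots> < \<infinity>" by (simp add: ennreal_mult_less_top power_less_top_ennreal)
  finally show ?thesis by (intro integrableI_bounded) auto
qed

section \<open>Integrability of the trilinear integrand\<close>

lemma norm_matrix_vector_mult_le: "norm (A *v x) \<le> norm A * norm x" for A :: "real ^ 'n ^ 'm"
proof -
  have "(norm (A *v x))\<^sup>2 = (\<Sum>i\<in>UNIV. (A $ i \<bullet> x)\<^sup>2)"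
    by (simp add: norm_vec_def L2_set_def sum_nonneg matrix_vector_mul_component)
  also have "\<dots> \<le> (\<Sum>i\<in>UNIV. (norm (A $ i))\<^sup>2 * (norm x)\<^sup>2)"
    by (intro sum_mono) (simp add: Cauchy_Schwarz_ineq power2_norm_eq_inner)
  also have "\<dots> = (norm A)\<^sup>2 * (norm x)\<^sup>2"
    by (simp add: norm_vec_def L2_set_def sum_nonneg sum_distrib_right)
  finally have "(norm (A *v x))\<^sup>2 \<le> (norm A * norm x)\<^sup>2" by (simp add: power_mult_distrib)
  then show ?thesis by (rule power2_le_imp_le) simp
qed

lemma velocity_H1: "v \<in> velocity_space \<Omega> \<Longrightarrow> (\<lambda>x. v x $ i) \<in> H1 \<Omega>"
  by (simp add: velocity_space_def H10_def)

lemma L2_of_H1_components: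
  fixes v :: "real ^ 'n \<Rightarrow> real ^ 'n"
  assumes "\<And>i. (\<lambda>x. v x $ i) \<in> H1 \<Omega>"
  shows "v \<in> L2 \<Omega>" "grad \<Omega> v \<in> L2 \<Omega>"
  using L2_vec_lambda[of "\<lambda>i x. v x $ i", OF H1_L2[OF assms]] 
    L2_vec_lambda[of "\<lambda>i. weak_gradient \<Omega> (\<lambda>y. v y $ i)", OF weak_gradient_L2[OF assms]]
  by (simp_all add: grad_def[abs_def])

lemma velocity_L4:
  fixes v :: "real ^ 'n \<Rightarrow> real ^ 'n"
  assumes dim: "CARD('n) = 2 \<or> CARD('n) = 3" and \<Omega>: "open \<Omega>" and v: "v \<in> velocity_space \<Omega>"
  shows "integrable (lebesgue_on \<Omega>) (\<lambda>x. norm (v x) ^ 4)"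
proof (rule Bochner_Integration.integrable_bound[of _ "\<lambda>x. (\<Sum>i\<in>UNIV. (v x $ i) ^ 4) * real CARD('n)"])
  show "integrable (lebesgue_on \<Omega>) (\<lambda>x. (\<Sum>i\<in>UNIV. (v x $ i) ^ 4) * real CARD('n))"
    using v by (intro integrable_mult_left Bochner_Integration.integrable_sum H10_L4[OF dim \<Omega>]) (auto simp: velocity_space_def)
  note [measurable] = L2_measurable[OF L2_of_H1_components(1)[OF velocity_H1[OF v]]]
  show "(\<lambda>x. norm (v x) ^ 4) \<in> borel_measurable (lebesgue_on \<Omega>)" by measurable
  have "norm (v x) ^ 4 \<le> (\<Sum>i\<in>UNIV. (v x $ i) ^ 4) * real CARD('n)" for x
  proof -
    have "norm (v x) ^ 4 = ((norm (v x))\<^sup>2)\<^sup>2" by simp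
    also have "(norm (v x))\<^sup>2 = (\<Sum>i\<in>UNIV. (v x $ i)\<^sup>2)"
      by (simp add: norm_vec_def L2_set_def sum_nonneg)
    also have "(\<Sum>i\<in>UNIV. (v x $ i)\<^sup>2)\<^sup>2 \<le> (\<Sum>i\<in>UNIV. ((v x $ i)\<^sup>2)\<^sup>2) * real CARD('n)"
      using sum_squared_le_sum_of_squares[of "\<lambda>i. (v x $ i)\<^sup>2" UNIV] by (simp add: mult.commute)
    finally show ?thesis by simp
  qed
  then show "AE x in lebesgue_on \<Omega>. norm (norm (v x) ^ 4) \<le> norm ((\<Sum>i\<in>UNIV. (v x $ i) ^ 4) * real CARD('n))"
    by (intro AE_I2) (simp add: abs_of_nonneg sum_nonneg)
qed

text \<open>Plays the part of Hoelder's inequality with exponents 2, 4, 4, through a pointwise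
  majorant from two quadratic inequalities. \<open>g\<close> is any L^2 field, so gradients of
  differences are covered. Measurability is recorded separately for comparing integrals of functions
  that agree almost everywhere.\<close>

lemma trilinear_integrable:
  fixes v w :: "real ^ 'n \<Rightarrow> real ^ 'n" and g :: "real ^ 'n \<Rightarrow> real ^ 'n ^ 'n"
  assumes dim: "CARD('n) = 2 \<or> CARD('n) = 3" and \<Omega>: "open \<Omega>" 
    and v: "v \<in> velocity_space \<Omega>" and w: "w \<in> velocity_space \<Omega>" and g: "g \<in> L2 \<Omega>"
  shows "integrable (lebesgue_on \<Omega>) (\<lambda>x. (g x *v w x) \<bullet> v x)"
    "(\<lambda>x. (g x *v w x) \<bullet> v x) \<in> borel_measurable (lebesgue_on \<Omega>)"
proof -
  have m: "w \<in> borel_measurable (lebesgue_on \<Omega>)" "v \<in> borel_measurable (lebesgue_on \<Omega>)" "g \<in> borel_measurable (lebesgue_on \<Omega>)"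
    using L2_measurable[OF L2_of_H1_components(1)[OF velocity_H1[OF v]]]
      L2_measurable[OF L2_of_H1_components(1)[OF velocity_H1[OF w]]] L2_measurable[OF g] by auto
  have "(\<lambda>x. \<chi> i. g x $ i \<bullet> w x) \<in> borel_measurable (lebesgue_on \<Omega>)"
    by (intro borel_measurable_vec_lambda borel_measurable_inner m borel_measurable_vec_nth)
  also have "(\<lambda>x. \<chi> i. g x $ i \<bullet> w x) = (\<lambda>x. g x *v w x)"
    by (simp add: fun_eq_iff vec_eq_iff matrix_vector_mul_component)
  finally show m': "(\<lambda>x. (g x *v w x) \<bullet> v x) \<in> borel_measurable (lebesgue_on \<Omega>)"
    by (intro borel_measurable_inner m)
  show "integrable (lebesgue_on \<Omega>) (\<lambda>x. (g x *v w x) \<bullet> v x)"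
  proof (rule Bochner_Integration.integrable_bound[OF _ m'])
    show "integrable (lebesgue_on \<Omega>) (\<lambda>x. (norm (g x))\<^sup>2 + (norm (w x) ^ 4 + norm (v x) ^ 4))"
      by (intro Bochner_Integration.integrable_add velocity_L4[OF dim \<Omega>] v w L2_integrable g)
    have "\<bar>(g x *v w x) \<bullet> v x\<bar> \<le> (norm (g x))\<^sup>2 + (norm (w x) ^ 4 + norm (v x) ^ 4)" for x
    proof -
      have "\<bar>(g x *v w x) \<bullet> v x\<bar> \<le> (norm (g x) * norm (w x)) * norm (v x)"
        by (intro order_trans[OF Cauchy_Schwarz_ineq2] mult_right_mono norm_matrix_vector_mult_le) auto
      also have "\<dots> = norm (g x) * (norm (w x) * norm (v x))" by simp
      \<comment> \<open>Doubling prepares the form 2 a b \<le> a^2 + b^2 of the next bound.\<close>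
      also have "\<dots> \<le> (2 * norm (g x) * (norm (w x) * norm (v x)))" by simp
      also have "\<dots> \<le> (norm (g x))\<^sup>2 + (norm (w x) * norm (v x))\<^sup>2" by (rule sum_squares_bound)
      also have "(norm (w x) * norm (v x))\<^sup>2 = (norm (w x))\<^sup>2 * (norm (v x))\<^sup>2" by (simp add: power_mult_distrib)
      also have "\<dots> \<le> ((norm (w x))\<^sup>2)\<^sup>2 + ((norm (v x))\<^sup>2)\<^sup>2" by (rule mult_le_sum_squares)
      finally show ?thesis by simp
    qed
    then show "AE x in lebesgue_on \<Omega>. norm ((g x *v w x) \<bullet> v x) \<le> norm ((norm (g x))\<^sup>2 + (norm (w x) ^ 4 + norm (v x) ^ 4))"
      by (intro AE_I2) (simp add: abs_of_nonneg)
  qed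
qed

section \<open>Velocity gradients and the trilinear form\<close>

text \<open>Linearity of gradients is proved in H^1, where closure under linear combinations comes
  with it; that the differences used later lie in the velocity space is taken from the POD
  space.\<close>

definition H1_vec :: "(real ^ 'n) set \<Rightarrow> (real ^ 'n \<Rightarrow> real ^ 'n) set" where
  "H1_vec \<Omega> = {v. \<forall>i. (\<lambda>x. v x $ i) \<in> H1 \<Omega>}"

lemma velocity_space_H1_vec: "velocity_space \<Omega> \<subseteq> H1_vec \<Omega>"
  by (auto simp: H1_vec_def intro: velocity_H1)

lemma H1_vec_L2: "v \<in> H1_vec \<Omega> \<Longrightarrow> v \<in> L2 \<Omega>"
  and grad_L2: "v \<in> H1_vec \<Omega> \<Longrightarrow> grad \<Omega> v \<in> L2 \<Omega>"
  by (auto simp: H1_vec_def intro: L2_of_H1_components)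

lemma grad_lincomb:
  assumes \<Omega>: "open \<Omega>" and u: "u \<in> H1_vec \<Omega>" and v: "v \<in> H1_vec \<Omega>"
  shows "(\<lambda>x. a *\<^sub>R u x + b *\<^sub>R v x) \<in> H1_vec \<Omega>"
    "AE x in lebesgue_on \<Omega>. grad \<Omega> (\<lambda>x. a *\<^sub>R u x + b *\<^sub>R v x) x = a *\<^sub>R grad \<Omega> u x + b *\<^sub>R grad \<Omega> v x"
proof -
  have "(\<lambda>x. u x $ i) \<in> H1 \<Omega>" "(\<lambda>x. v x $ i) \<in> H1 \<Omega>" for i using u v by (auto simp: H1_vec_def)
  note w = weak_gradient_lincomb[OF \<Omega> this, of a _ b]
  show "(\<lambda>x. a *\<^sub>R u x + b *\<^sub>R v x) \<in> H1_vec \<Omega>" using w(1) by (simp add: H1_vec_def)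
  have "AE x in lebesgue_on \<Omega>. \<forall>i. weak_gradient \<Omega> (\<lambda>x. a * u x $ i + b * v x $ i) x = a *\<^sub>R weak_gradient \<Omega> (\<lambda>x. u x $ i) x + b *\<^sub>R weak_gradient \<Omega> (\<lambda>x. v x $ i) x"
    using w(2) by (subst AE_all_countable) blast
  then show "AE x in lebesgue_on \<Omega>. grad \<Omega> (\<lambda>x. a *\<^sub>R u x + b *\<^sub>R v x) x = a *\<^sub>R grad \<Omega> u x + b *\<^sub>R grad \<Omega> v x"
    by eventually_elim (simp add: grad_def vec_eq_iff)
qed

lemma grad_diff:
  assumes \<Omega>: "open \<Omega>" and u: "u \<in> H1_vec \<Omega>" and v: "v \<in> H1_vec \<Omega>"
  shows "(\<lambda>x. u x - v x) \<in> H1_vec \<Omega>"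
    "AE x in lebesgue_on \<Omega>. grad \<Omega> (\<lambda>x. u x - v x) x = grad \<Omega> u x - grad \<Omega> v x"
  using grad_lincomb[OF assms, of 1 "-1"] by simp_all

lemma grad_zero:
  assumes "open \<Omega>"
  shows "(\<lambda>x. 0) \<in> H1_vec \<Omega>" "AE x in lebesgue_on \<Omega>. grad \<Omega> (\<lambda>x. 0) x = 0"
proof -
  have "is_weak_gradient \<Omega> (\<lambda>x. 0) (\<lambda>x. 0)" by (simp add: is_weak_gradient_def L2_zero)
  then have "(\<lambda>x. 0) \<in> H1 \<Omega>" by (auto simp: H1_def L2_zero)
  then show *: "(\<lambda>x. 0) \<in> H1_vec \<Omega>" by (simp add: H1_vec_def)
  show "AE x in lebesgue_on \<Omega>. grad \<Omega> (\<lambda>x. 0) x = 0"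
    using grad_lincomb[OF assms * *, of 0 0] by simp
qed

lemma grad_sum:
  assumes \<Omega>: "open \<Omega>" and \<phi>: "\<And>a. a \<in> A \<Longrightarrow> \<phi> a \<in> H1_vec \<Omega>"
  shows "(\<lambda>x. \<Sum>a\<in>A. c a *\<^sub>R \<phi> a x) \<in> H1_vec \<Omega> \<and>
    (AE x in lebesgue_on \<Omega>. grad \<Omega> (\<lambda>x. \<Sum>a\<in>A. c a *\<^sub>R \<phi> a x) x = (\<Sum>a\<in>A. c a *\<^sub>R grad \<Omega> (\<phi> a) x))"
  using \<phi>
proof (induction A rule: infinite_finite_induct)
  case (insert a A)
  have IH: "(\<lambda>x. \<Sum>a\<in>A. c a *\<^sub>R \<phi> a x) \<in> H1_vec \<Omega>" 
    "AE x in lebesgue_on \<Omega>. grad \<Omega> (\<lambda>x. \<Sum>a\<in>A. c a *\<^sub>R \<phi> a x) x = (\<Sum>a\<in>A. c a *\<^sub>R grad \<Omega> (\<phi> a) x)"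
    using insert by auto
  have a: "\<phi> a \<in> H1_vec \<Omega>" using insert by auto
  note w = grad_lincomb[OF \<Omega> a IH(1), of "c a" 1]
  have "AE x in lebesgue_on \<Omega>. grad \<Omega> (\<lambda>x. c a *\<^sub>R \<phi> a x + (\<Sum>a\<in>A. c a *\<^sub>R \<phi> a x)) x = c a *\<^sub>R grad \<Omega> (\<phi> a) x + (\<Sum>a\<in>A. c a *\<^sub>R grad \<Omega> (\<phi> a) x)"
    using w(2) IH(2) by eventually_elim simp
  with w(1) show ?case using insert(1,2) by simp
qed (use grad_zero[OF \<Omega>] in auto)

text \<open>Each half of b* splits because both resulting integrals exist. In the first half the
  last argument enters pointwise; in the second it enters through its gradient, which is additive
  almost everywhere.\<close>

lemma bstar_diff_right:
  fixes w u v1 v2 :: "real ^ 'n \<Rightarrow> real ^ 'n"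
  assumes dim: "CARD('n) = 2 \<or> CARD('n) = 3" and \<Omega>: "open \<Omega>"
    and w: "w \<in> velocity_space \<Omega>" and u: "u \<in> velocity_space \<Omega>"
    and v1: "v1 \<in> velocity_space \<Omega>" and v2: "v2 \<in> velocity_space \<Omega>" 
    and v: "(\<lambda>x. v1 x - v2 x) \<in> velocity_space \<Omega>"
  shows "bstar \<Omega> w u (\<lambda>x. v1 x - v2 x) = bstar \<Omega> w u v1 - bstar \<Omega> w u v2"
proof -
  note T = trilinear_integrable[OF dim \<Omega> _ w]
  have g: "grad \<Omega> x \<in> L2 \<Omega>" if "x \<in> velocity_space \<Omega>" for x
    using that velocity_space_H1_vec grad_L2 by blast
  have 1: "L2_inner \<Omega> (\<lambda>x. grad \<Omega> u x *v w x) (\<lambda>x. v1 x - v2 x) = 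
     L2_inner \<Omega> (\<lambda>x. grad \<Omega> u x *v w x) v1 - L2_inner \<Omega> (\<lambda>x. grad \<Omega> u x *v w x) v2"
    unfolding L2_inner_def inner_diff_right
    by (intro Bochner_Integration.integral_diff T v1 v2 g u)
  have "AE x in lebesgue_on \<Omega>. grad \<Omega> (\<lambda>x. v1 x - v2 x) x = grad \<Omega> v1 x - grad \<Omega> v2 x"
    using velocity_space_H1_vec v1 v2 by (intro grad_diff[OF \<Omega>]) auto
  then have ae: "AE x in lebesgue_on \<Omega>. (grad \<Omega> (\<lambda>x. v1 x - v2 x) x *v w x) \<bullet> u x = 
     (grad \<Omega> v1 x *v w x) \<bullet> u x - (grad \<Omega> v2 x *v w x) \<bullet> u x"
    by eventually_elim (simp add: matrix_vector_mult_diff_rdistrib inner_diff_left)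
  have 2: "L2_inner \<Omega> (\<lambda>x. grad \<Omega> (\<lambda>x. v1 x - v2 x) x *v w x) u =
     L2_inner \<Omega> (\<lambda>x. grad \<Omega> v1 x *v w x) u - L2_inner \<Omega> (\<lambda>x. grad \<Omega> v2 x *v w x) u"
  proof -
    have "L2_inner \<Omega> (\<lambda>x. grad \<Omega> (\<lambda>x. v1 x - v2 x) x *v w x) u = 
      integral\<^sup>L (lebesgue_on \<Omega>) (\<lambda>x. (grad \<Omega> v1 x *v w x) \<bullet> u x - (grad \<Omega> v2 x *v w x) \<bullet> u x)"
      unfolding L2_inner_def using ae
      by (rule integral_cong_AE[rotated 2]) (intro T u g v v1 v2 borel_measurable_diff)+
    then show ?thesis unfolding L2_inner_def
      by (simp add: Bochner_Integration.integral_diff T(1) u g v1 v2)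
  qed
  show ?thesis unfolding bstar_def 1 2 by (simp add: algebra_simps)
qed

section \<open>The POD space\<close>

text \<open>Coordinates in \<open>real ^ 'r\<close>, which turn questions about the POD space into
  linear algebra.\<close>

definition pod_elem :: "('r::finite \<Rightarrow> real ^ 'n \<Rightarrow> real ^ 'n) \<Rightarrow> real ^ 'r \<Rightarrow> real ^ 'n \<Rightarrow> real ^ 'n" where
  "pod_elem \<phi> c x = (\<Sum>i\<in>UNIV. c $ i *\<^sub>R \<phi> i x)"

text \<open>\<open>fun_span\<close> indexes coefficients by the functions themselves. Orthonormality
  makes \<open>\<phi>\<close> injective, so they can be reindexed by \<open>'r\<close>.\<close>

lemma pod_space_eq:
  assumes "L2_orthonormal \<Omega> \<phi>"
  shows "pod_space \<phi> = range (pod_elem \<phi>)"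
proof -
  have "inj \<phi>"
  proof (rule injI, rule ccontr)
    fix i j assume "\<phi> i = \<phi> j" "i \<noteq> j"
    then have "L2_inner \<Omega> (\<phi> i) (\<phi> i) = L2_inner \<Omega> (\<phi> i) (\<phi> j)" by simp
    with \<open>i \<noteq> j\<close> assms show False by (simp add: L2_orthonormal_def)
  qed
  then have s: "(\<Sum>b\<in>range \<phi>. c b *\<^sub>R b x) = (\<Sum>i\<in>UNIV. c (\<phi> i) *\<^sub>R \<phi> i x)" for c x
    by (simp add: sum.reindex)
  show ?thesis
  proof (intro equalityI subsetI)
    fix u assume "u \<in> pod_space \<phi>"
    then obtain c where "u = (\<lambda>x. \<Sum>b\<in>range \<phi>. c b *\<^sub>R b x)" by (auto simp: pod_space_def fun_span_def)
    then have "u = pod_elem \<phi> (\<chi> i. c (\<phi> i))" by (simp add: fun_eq_iff s pod_elem_def)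
    then show "u \<in> range (pod_elem \<phi>)" by blast
  next
    fix u assume "u \<in> range (pod_elem \<phi>)"
    then obtain c where "u = pod_elem \<phi> c" by blast
    then have "u = (\<lambda>x. \<Sum>b\<in>range \<phi>. (c $ inv \<phi> b) *\<^sub>R b x)"
      using \<open>inj \<phi>\<close> by (simp add: fun_eq_iff s pod_elem_def)
    then show "u \<in> pod_space \<phi>" by (auto simp: pod_space_def fun_span_def)
  qed
qed

lemma pod_elem_lincomb: "pod_elem \<phi> (a *\<^sub>R c + b *\<^sub>R d) = (\<lambda>x. a *\<^sub>R pod_elem \<phi> c x + b *\<^sub>R pod_elem \<phi> d x)"
  by (simp add: fun_eq_iff pod_elem_def scaleR_left_distrib sum.distrib scaleR_right.sum)

lemma pod_elem_diff: "pod_elem \<phi> (c - d) = (\<lambda>x. pod_elem \<phi> c x - pod_elem \<phi> d x)"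
  using pod_elem_lincomb[of \<phi> 1 c "-1" d] by simp

lemma L2_inner_pod_left:
  assumes "\<And>i. \<phi> i \<in> L2 \<Omega>" "v \<in> L2 \<Omega>"
  shows "L2_inner \<Omega> (pod_elem \<phi> c) v = (\<Sum>i\<in>UNIV. c $ i * L2_inner \<Omega> (\<phi> i) v)"
  unfolding pod_elem_def[abs_def] using assms
  by (simp add: L2_inner_sum_left L2_scaleR L2_inner_scaleR_left)

lemma pod_elem_L2:
  assumes "\<And>i. \<phi> i \<in> L2 \<Omega>"
  shows "pod_elem \<phi> c \<in> L2 \<Omega>"
  unfolding pod_elem_def[abs_def] by (intro L2_sum L2_scaleR assms)

lemma L2_inner_pod:
  assumes "L2_orthonormal \<Omega> \<phi>"
  shows "L2_inner \<Omega> (pod_elem \<phi> c) (pod_elem \<phi> d) = c \<bullet> d"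
proof -
  have L: "\<phi> i \<in> L2 \<Omega>" for i using assms by (simp add: L2_orthonormal_def)
  have "L2_inner \<Omega> (\<phi> i) (pod_elem \<phi> d) = d $ i" for i
  proof -
    have "L2_inner \<Omega> (\<phi> i) (pod_elem \<phi> d) = (\<Sum>j\<in>UNIV. d $ j * L2_inner \<Omega> (\<phi> j) (\<phi> i))"
      unfolding L2_inner_commute[of \<Omega> "\<phi> i"] by (rule L2_inner_pod_left[where \<phi>=\<phi>, OF L L])
    also have "\<dots> = (\<Sum>j\<in>UNIV. if j = i then d $ j else 0)"
      using assms by (intro sum.cong) (auto simp: L2_orthonormal_def)
    finally show ?thesis by simp
  qed
  then show ?thesis using L2_inner_pod_left[where \<phi>=\<phi>, OF L pod_elem_L2[where \<phi>=\<phi>, OF L]] by (simp add: inner_vec_def)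
qed

lemma pod_elem_grad:
  assumes "open \<Omega>" "\<And>i. \<phi> i \<in> H1_vec \<Omega>"
  shows "pod_elem \<phi> c \<in> H1_vec \<Omega>"
    "AE x in lebesgue_on \<Omega>. grad \<Omega> (pod_elem \<phi> c) x = (\<Sum>i\<in>UNIV. c $ i *\<^sub>R grad \<Omega> (\<phi> i) x)"
  using grad_sum[OF assms(1), of UNIV \<phi> "\<lambda>i. c $ i"] assms(2) by (simp_all add: pod_elem_def[abs_def])

lemma L2_inner_grad_pod_left:
  assumes \<Omega>: "open \<Omega>" and \<phi>: "\<And>i. \<phi> i \<in> H1_vec \<Omega>" and v: "v \<in> H1_vec \<Omega>"
  shows "L2_inner \<Omega> (grad \<Omega> (pod_elem \<phi> c)) (grad \<Omega> v) = (\<Sum>i\<in>UNIV. c $ i * L2_inner \<Omega> (grad \<Omega> (\<phi> i)) (grad \<Omega> v))"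
proof -
  have "L2_inner \<Omega> (grad \<Omega> (pod_elem \<phi> c)) (grad \<Omega> v) = L2_inner \<Omega> (\<lambda>x. \<Sum>i\<in>UNIV. c $ i *\<^sub>R grad \<Omega> (\<phi> i) x) (grad \<Omega> v)"
    using pod_elem_grad[where \<phi>=\<phi> and c=c, OF \<Omega> \<phi>] 
    by (intro L2_inner_cong_AE L2_sum L2_scaleR grad_L2 v \<phi>) auto
  then show ?thesis
    using \<phi> v by (simp add: L2_inner_sum_left L2_scaleR L2_inner_scaleR_left grad_L2)
qed

lemma L2_inner_grad_pod:
  assumes \<Omega>: "open \<Omega>" and \<phi>: "\<And>i. \<phi> i \<in> H1_vec \<Omega>"
  shows "L2_inner \<Omega> (grad \<Omega> (pod_elem \<phi> c)) (grad \<Omega> (pod_elem \<phi> d)) = c \<bullet> (pod_stiffness \<Omega> \<phi> *v d)"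
proof -
  have "L2_inner \<Omega> (grad \<Omega> (\<phi> i)) (grad \<Omega> (pod_elem \<phi> d)) = (pod_stiffness \<Omega> \<phi> *v d) $ i" for i
    unfolding L2_inner_commute[of \<Omega> "grad \<Omega> (\<phi> i)"] L2_inner_grad_pod_left[where \<phi>=\<phi>, OF \<Omega> \<phi> \<phi>]
    by (auto simp: matrix_vector_mult_def pod_stiffness_def mult.commute L2_inner_commute intro!: sum.cong)
  then show ?thesis by (simp add: L2_inner_grad_pod_left[where \<phi>=\<phi>, OF \<Omega> \<phi> pod_elem_grad(1)[where \<phi>=\<phi>, OF \<Omega> \<phi>]] inner_vec_def)
qed

lemma matrix_norm2_nonneg: "0 \<le> matrix_norm2 A"
  unfolding matrix_norm2_def by (intro onorm_pos_le matrix_vector_mul_bounded_linear)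

text \<open>In coordinates the squared gradient norm is the quadratic form of the stiffness matrix,
  at most its 2-norm times |c|^2, and |c| is the L^2 norm of \<open>v\<close> by
  orthonormality.\<close>

lemma pod_inverse_estimate:
  assumes \<Omega>: "open \<Omega>" and \<phi>: "\<And>i. \<phi> i \<in> H1_vec \<Omega>" and orth: "L2_orthonormal \<Omega> \<phi>"
    and v: "v \<in> pod_space \<phi>"
  shows "L2_norm \<Omega> (grad \<Omega> v) \<le> sqrt (matrix_norm2 (pod_stiffness \<Omega> \<phi>)) * L2_norm \<Omega> v"
proof -
  obtain c where v: "v = pod_elem \<phi> c" using v pod_space_eq[OF orth] by auto
  have "(L2_norm \<Omega> (grad \<Omega> v))\<^sup>2 = c \<bullet> (pod_stiffness \<Omega> \<phi> *v c)"
    by (simp add: L2_norm_square v L2_inner_grad_pod[where \<phi>=\<phi>, OF \<Omega> \<phi>])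
  also have "\<dots> \<le> norm c * norm (pod_stiffness \<Omega> \<phi> *v c)" by (rule norm_cauchy_schwarz)
  also have "\<dots> \<le> norm c * (matrix_norm2 (pod_stiffness \<Omega> \<phi>) * norm c)"
    unfolding matrix_norm2_def by (intro mult_left_mono onorm matrix_vector_mul_bounded_linear) auto
  also have "\<dots> = (sqrt (matrix_norm2 (pod_stiffness \<Omega> \<phi>)) * L2_norm \<Omega> v)\<^sup>2"
  proof -
    have "(L2_norm \<Omega> v)\<^sup>2 = norm c * norm c"
      by (simp add: L2_norm_square v L2_inner_pod[OF orth] flip: power2_norm_eq_inner power2_eq_square)
    then show ?thesis by (simp add: power_mult_distrib matrix_norm2_nonneg)
  qed
  finally show ?thesis
    by (rule power2_le_imp_le) (simp add: L2_norm_nonneg matrix_norm2_nonneg)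
qed

text \<open>In coordinates the filter equation reads (\<delta>^2 S + I) c = b. The matrix is
  positive definite, hence injective and, in finite dimension, surjective. Unique solvability is
  what gives the \<open>THE\<close> in \<open>rom_filter\<close> its meaning.\<close>

lemma rom_filter_in_pod_space:
  fixes \<phi> :: "'r::finite \<Rightarrow> real ^ 'n \<Rightarrow> real ^ 'n"
  assumes \<Omega>: "open \<Omega>" and \<phi>: "\<And>i. \<phi> i \<in> H1_vec \<Omega>" and orth: "L2_orthonormal \<Omega> \<phi>" and v: "v \<in> L2 \<Omega>"
  shows "rom_filter \<Omega> \<delta> (pod_space \<phi>) v \<in> pod_space \<phi>"
proof -
  have L: "\<phi> i \<in> L2 \<Omega>" for i using orth by (simp add: L2_orthonormal_def)
  let ?S = "pod_stiffness \<Omega> \<phi>"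
  let ?f = "\<lambda>c. \<delta>\<^sup>2 *\<^sub>R (?S *v c) + c"
  define b where "b = (\<chi> i. L2_inner \<Omega> (\<phi> i) v)"
  have vb: "L2_inner \<Omega> v (pod_elem \<phi> d) = d \<bullet> b" for d
    unfolding L2_inner_commute[of \<Omega> v] L2_inner_pod_left[where \<phi>=\<phi>, OF L v] by (simp add: inner_vec_def b_def)
  have eq: "(\<forall>\<psi>\<in>pod_space \<phi>. \<delta>\<^sup>2 * L2_inner \<Omega> (grad \<Omega> (pod_elem \<phi> c)) (grad \<Omega> \<psi>) + L2_inner \<Omega> (pod_elem \<phi> c) \<psi> = L2_inner \<Omega> v \<psi>)
     \<longleftrightarrow> ?f c = b" for c
  proof -
    have "\<delta>\<^sup>2 * L2_inner \<Omega> (grad \<Omega> (pod_elem \<phi> c)) (grad \<Omega> (pod_elem \<phi> d)) + L2_inner \<Omega> (pod_elem \<phi> c) (pod_elem \<phi> d) = d \<bullet> ?f c" for d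
      unfolding L2_inner_commute[of \<Omega> "grad \<Omega> (pod_elem \<phi> c)"] L2_inner_commute[of \<Omega> "pod_elem \<phi> c"]
      by (simp add: L2_inner_grad_pod[where \<phi>=\<phi>, OF \<Omega> \<phi>] L2_inner_pod[OF orth] inner_add_right)
    then have "(\<forall>\<psi>\<in>pod_space \<phi>. \<delta>\<^sup>2 * L2_inner \<Omega> (grad \<Omega> (pod_elem \<phi> c)) (grad \<Omega> \<psi>) + L2_inner \<Omega> (pod_elem \<phi> c) \<psi> = L2_inner \<Omega> v \<psi>)
      \<longleftrightarrow> (\<forall>d. d \<bullet> ?f c = d \<bullet> b)"
      unfolding pod_space_eq[OF orth] by (auto simp: vb)
    also have "\<dots> \<longleftrightarrow> ?f c = b" using vector_eq_ldot[of "?f c" b] by auto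
    finally show ?thesis .
  qed
  have lin: "linear ?f"
    by (intro linearI) (simp_all add: matrix_vector_right_distrib scaleR_right_distrib matrix_vector_mult_scaleR algebra_simps)
  have inj: "inj ?f"
  proof (subst linear_injective_0[OF lin], intro allI impI)
    fix c assume "?f c = 0"
    then have "c \<bullet> ?f c = 0" by simp
    \<comment> \<open>The stiffness matrix is positive semidefinite, since its quadratic form is a
      squared gradient norm.\<close>
    moreover have "0 \<le> c \<bullet> (?S *v c)" using L2_inner_nonneg[of \<Omega> "grad \<Omega> (pod_elem \<phi> c)"] by (simp add: L2_inner_grad_pod[where \<phi>=\<phi>, OF \<Omega> \<phi>])
    then have "0 \<le> \<delta>\<^sup>2 * (c \<bullet> (?S *v c))" by simp
    ultimately have "c \<bullet> c \<le> 0" by (simp add: inner_add_right)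
    then show "c = 0" by (metis inner_ge_zero inner_eq_zero_iff order_antisym)
  qed
  have "surj ?f" by (rule linear_injective_imp_surjective[OF lin inj refl])
  then obtain c where c: "b = ?f c" by (rule surjE)
  have "\<exists>!w. w \<in> pod_space \<phi> \<and> (\<forall>\<psi>\<in>pod_space \<phi>. \<delta>\<^sup>2 * L2_inner \<Omega> (grad \<Omega> w) (grad \<Omega> \<psi>) + L2_inner \<Omega> w \<psi> = L2_inner \<Omega> v \<psi>)"
  proof (rule ex1I[of _ "pod_elem \<phi> c"])
    show "pod_elem \<phi> c \<in> pod_space \<phi> \<and> (\<forall>\<psi>\<in>pod_space \<phi>. \<delta>\<^sup>2 * L2_inner \<Omega> (grad \<Omega> (pod_elem \<phi> c)) (grad \<Omega> \<psi>) + L2_inner \<Omega> (pod_elem \<phi> c) \<psi> = L2_inner \<Omega> v \<psi>)"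
      unfolding eq using c pod_space_eq[OF orth] by blast
    fix w assume w: "w \<in> pod_space \<phi> \<and> (\<forall>\<psi>\<in>pod_space \<phi>. \<delta>\<^sup>2 * L2_inner \<Omega> (grad \<Omega> w) (grad \<Omega> \<psi>) + L2_inner \<Omega> w \<psi> = L2_inner \<Omega> v \<psi>)"
    then obtain d where d: "w = pod_elem \<phi> d" using pod_space_eq[OF orth] by auto
    have "?f d = b" using w eq unfolding d by blast
    then have "?f d = ?f c" using c by (rule trans)
    then have "d = c" by (rule injD[OF inj])
    then show "w = pod_elem \<phi> c" by (simp add: d)
  qed
  from theI'[OF this] show ?thesis unfolding rom_filter_def by blast
qed

section \<open>Energy estimate\<close>

text \<open>The real arithmetic of one time step. Primes mark the new level. \<open>A\<close> and
  \<open>G\<close> stand for the norms of the velocity and of its gradient, \<open>D\<close> and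
  \<open>GD\<close> for those of the increment, \<open>W\<close> for the gradient norm of the
  filtered fluctuation, and \<open>S\<close> for the 2-norm of the stiffness matrix;
  \<open>p\<close> and \<open>q\<close> are the inner products of old and new velocities and of
  their gradients. The polarization identity for D^2 replaces \<open>p\<close> and brings in the
  numerical dissipation.\<close>

lemma energy_step_inequality:
  fixes A A' D G G' GD W S :: real
  assumes pos: "\<nu>max > 0" "dt > 0" "C > 0" and nonneg: "0 \<le> D" "0 \<le> G" "0 \<le> GD" "0 \<le> W" "0 \<le> S"
    and eq: "(1 / dt) * (A'\<^sup>2 - p) + b + \<nu>max * G'\<^sup>2 + (\<nu>j - \<nu>max) * q = F"
    and p: "D\<^sup>2 = A'\<^sup>2 - 2 * p + A\<^sup>2" and q: "\<bar>q\<bar> \<le> (G\<^sup>2 + G'\<^sup>2) / 2"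
    and b: "- b \<le> C * W * G * sqrt (D * GD)" and inv: "GD \<le> sqrt S * D"
    and stab: "C\<^sup>2 * dt / \<nu>max * sqrt S * W\<^sup>2 \<le> \<epsilon>"
    and \<epsilon>: "\<bar>\<nu>j - \<nu>max\<bar> \<le> (1 - \<epsilon>) * \<nu>max"
  shows "1/2 * A'\<^sup>2 + \<nu>max * dt / 2 * G'\<^sup>2 + \<epsilon> * \<nu>max * dt / 2 * G'\<^sup>2 \<le>
    1/2 * A\<^sup>2 + \<nu>max * dt / 2 * G\<^sup>2 + dt * F"
proof -
  have "A'\<^sup>2 - p + dt * b + dt * \<nu>max * G'\<^sup>2 + dt * (\<nu>j - \<nu>max) * q = dt * F"
    using pos unfolding eq[symmetric] by (simp add: field_simps)
  then have e: "1/2 * A'\<^sup>2 + dt * \<nu>max * G'\<^sup>2 = 1/2 * A\<^sup>2 - 1/2 * D\<^sup>2 + dt * (- b) + dt * (- ((\<nu>j - \<nu>max) * q)) + dt * F"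
    using p by (simp add: algebra_simps)
  have "- ((\<nu>j - \<nu>max) * q) \<le> \<bar>\<nu>j - \<nu>max\<bar> * \<bar>q\<bar>" by (simp add: abs_mult[symmetric])
  also have "\<dots> \<le> ((1 - \<epsilon>) * \<nu>max) * ((G\<^sup>2 + G'\<^sup>2) / 2)" by (intro mult_mono \<epsilon> q) (use \<epsilon> in auto)
  finally have q': "dt * (- ((\<nu>j - \<nu>max) * q)) \<le> dt * (((1 - \<epsilon>) * \<nu>max) * ((G\<^sup>2 + G'\<^sup>2) / 2))"
    using pos by (intro mult_left_mono) auto
  \<comment> \<open>The fourth root of \<open>S\<close>: the inverse estimate under the square root
    gives sqrt (D GD) \<le> s D, and squaring \<open>s\<close> in Young's inequality produces the
    sqrt S of the time step condition.\<close>
  define s where "s = sqrt (sqrt S)"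
  have s2: "s\<^sup>2 = sqrt S" using nonneg by (simp add: s_def)
  have "sqrt (D * GD) \<le> sqrt (D * (sqrt S * D))" using inv nonneg by (intro real_sqrt_le_mono mult_left_mono)
  also have "\<dots> = s * D" using nonneg by (simp add: s_def real_sqrt_mult)
  finally have "- b \<le> C * W * G * (s * D)"
    using b pos nonneg by (meson mult_left_mono mult_nonneg_nonneg less_imp_le order_trans)
  then have "dt * (- b) \<le> dt * (C * W * G * (s * D))" using pos by (intro mult_left_mono) auto
  also have "\<dots> = (dt * C * W * G * s) * D" by simp
  \<comment> \<open>The factor \<open>D\<close> is kept unscaled, so that its share D^2 / 2 is
    cancelled exactly by the numerical dissipation.\<close>
  also have "\<dots> \<le> ((dt * C * W * G * s)\<^sup>2 + D\<^sup>2) / 2" using sum_squares_bound[of "dt * C * W * G * s" D] by simp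
  also have "(dt * C * W * G * s)\<^sup>2 = dt * \<nu>max * G\<^sup>2 * (C\<^sup>2 * dt / \<nu>max * sqrt S * W\<^sup>2)"
    using pos by (simp add: power_mult_distrib s2) (simp add: power2_eq_square)
  also have "\<dots> \<le> dt * \<nu>max * G\<^sup>2 * \<epsilon>" using pos by (intro mult_left_mono stab) auto
  finally have b': "dt * (- b) \<le> (dt * \<nu>max * G\<^sup>2 * \<epsilon> + D\<^sup>2) / 2" by simp
  show ?thesis using e q' b' by (simp add: field_simps)
qed

lemma ereal_square_nonneg: "0 \<le> (x :: ereal)\<^sup>2"
  by (cases x) (auto simp: power2_eq_square)

text \<open>Only a positive F needs an argument, and then \<open>v\<close> cannot vanish almost
  everywhere, so the quotient F / G takes part in the supremum. For positive G a completed square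
  trades the work of the force against a quarter of the \<epsilon>-weighted dissipation.\<close>

lemma dual_norm_young:
  assumes v: "v \<in> velocity_space \<Omega>" and pos: "\<nu>max > 0" "dt > 0" "\<epsilon> > 0"
  shows "ereal (dt * L2_inner \<Omega> f v - \<epsilon> * \<nu>max * dt / 4 * (L2_norm \<Omega> (grad \<Omega> v))\<^sup>2)
     \<le> ereal (dt / (\<nu>max * \<epsilon>)) * (dual_norm \<Omega> f)\<^sup>2"
proof -
  define F G where "F = L2_inner \<Omega> f v" and "G = L2_norm \<Omega> (grad \<Omega> v)"
  have G: "0 \<le> G" by (simp add: G_def L2_norm_nonneg)
  have c: "dt / (\<nu>max * \<epsilon>) > 0" using pos by simp
  have "ereal (dt * F - \<epsilon> * \<nu>max * dt / 4 * G\<^sup>2) \<le> ereal (dt / (\<nu>max * \<epsilon>)) * (dual_norm \<Omega> f)\<^sup>2"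
  proof (cases "F \<le> 0")
    case True
    then have "dt * F \<le> 0" using pos by (simp add: mult_nonneg_nonpos)
    moreover have "0 \<le> \<epsilon> * \<nu>max * dt / 4 * G\<^sup>2" using pos by simp
    ultimately have "ereal (dt * F - \<epsilon> * \<nu>max * dt / 4 * G\<^sup>2) \<le> 0" by simp
    moreover have "0 \<le> ereal (dt / (\<nu>max * \<epsilon>)) * (dual_norm \<Omega> f)\<^sup>2"
      using c by (intro ereal_0_le_mult ereal_square_nonneg) auto
    ultimately show ?thesis by (rule order_trans)
  next
    case False
    then have F: "F > 0" by simp
    have "\<not> ae_zero \<Omega> v"
    proof
      assume "ae_zero \<Omega> v"
      then have "F = 0" unfolding F_def L2_inner_def ae_zero_def
        by (intro integral_eq_zero_AE) (auto elim: AE_mp)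
      with F show False by simp
    qed
    then have le: "ereal F / ereal G \<le> dual_norm \<Omega> f"
      unfolding dual_norm_def F_def G_def using v by (intro SUP_upper) auto
    show ?thesis
    proof (cases "G = 0")
      case True
      (* F / 0 is infinite in ereal, so no Poincare inequality is needed. *)
      then have "dual_norm \<Omega> f = \<infinity>" using le F by (simp add: divide_ereal_def)
      then show ?thesis using pos by (simp add: power2_eq_square)
    next
      case False
      with G have G: "G > 0" by simp
      define t where "t = F / G"
      have t: "0 < t" "F = t * G" using F G by (auto simp: t_def)
      have le: "ereal t \<le> dual_norm \<Omega> f" using le G by (simp add: t_def)
      \<comment> \<open>With the shift \<nu>max \<epsilon> G / 2 the mixed term is dt t G = dt F and
        the last term is \<epsilon> \<nu>max dt G^2 / 4.\<close>
      have "0 \<le> dt / (\<nu>max * \<epsilon>) * (t - \<nu>max * \<epsilon> * G / 2)\<^sup>2" using pos by simp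
      also have "\<dots> = dt / (\<nu>max * \<epsilon>) * t\<^sup>2 - (dt * F - \<epsilon> * \<nu>max * dt / 4 * G\<^sup>2)"
        using pos by (simp add: t(2) power2_eq_square field_simps)
      finally have "ereal (dt * F - \<epsilon> * \<nu>max * dt / 4 * G\<^sup>2) \<le> ereal (dt / (\<nu>max * \<epsilon>)) * (ereal t)\<^sup>2"
        by (simp add: power2_eq_square)
      also have "\<dots> \<le> ereal (dt / (\<nu>max * \<epsilon>)) * (dual_norm \<Omega> f)\<^sup>2"
      proof (rule ereal_mult_left_mono)
        show "(ereal t)\<^sup>2 \<le> (dual_norm \<Omega> f)\<^sup>2"
          unfolding power2_eq_square using le t(1)
          by (intro ereal_mult_mono) (auto intro: order_trans[OF _ le])
      qed (use c in auto)
      finally show ?thesis .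
    qed
  qed
  then show ?thesis by (simp add: F_def G_def)
qed

theorem theorem4p1:
  fixes \<Omega> :: "(real ^ 'n) set"
    and Xh XR :: "(real ^ 'n \<Rightarrow> real ^ 'n) set" and Qh :: "(real ^ 'n \<Rightarrow> real) set"
    and snap :: "nat \<Rightarrow> nat \<Rightarrow> real ^ 'n \<Rightarrow> real ^ 'n" and I :: "(nat \<times> nat) set"
    and \<phi> :: "'r::finite \<Rightarrow> real ^ 'n \<Rightarrow> real ^ 'n"
    and C \<delta> dt \<nu>max \<epsilon> :: real and \<nu> :: "nat \<Rightarrow> real"
    and J N :: nat
    and f :: "nat \<Rightarrow> real \<Rightarrow> real ^ 'n \<Rightarrow> real ^ 'n"
    and u :: "nat \<Rightarrow> nat \<Rightarrow> real ^ 'n \<Rightarrow> real ^ 'n"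
    and mean :: "nat \<Rightarrow> real ^ 'n \<Rightarrow> real ^ 'n"
    and flt :: "(real ^ 'n \<Rightarrow> real ^ 'n) \<Rightarrow> real ^ 'n \<Rightarrow> real ^ 'n"
  assumes XR: "XR = pod_space \<phi>"
    and \<nu>max: "\<nu>max = Max (\<nu> ` {1..J})"
    and mean: "mean = (\<lambda>n. ensemble_mean J (\<lambda>j. u j n))"
    and flt: "flt = rom_filter \<Omega> \<delta> XR"
    and dim: "CARD('n) = 2 \<or> CARD('n) = 3"
    and domain: "regular_domain \<Omega>"
    and fe: "conforming_fe_pair \<Omega> Xh Qh"
    and C: "bstar_constant \<Omega> C"
    and snapshots: "finite I" "\<And>k l. (k, l) \<in> I \<Longrightarrow> snap k l \<in> discretely_div_free \<Omega> Xh Qh"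
    and pod: "pod_basis \<Omega> I snap \<phi>" "XR \<subseteq> discretely_div_free \<Omega> Xh Qh"
    and params: "\<delta> > 0" "dt > 0" "J \<ge> 1"
    and \<nu>_pos: "\<And>j. j \<in> {1..J} \<Longrightarrow> \<nu> j > 0"
    and forces: "\<And>j n. j \<in> {1..J} \<Longrightarrow> f j (real (n + 1) * dt) \<in> L2 \<Omega>"
    and u_in: "\<And>j n. j \<in> {1..J} \<Longrightarrow> u j n \<in> XR"
    and scheme: "\<And>j n v. j \<in> {1..J} \<Longrightarrow> v \<in> XR \<Longrightarrow>
        L2_inner \<Omega> (\<lambda>x. (1 / dt) *\<^sub>R (u j (n + 1) x - u j n x)) v
        + bstar \<Omega> (flt (mean n)) (u j (n + 1)) v
        + bstar \<Omega> (flt (\<lambda>x. u j n x - mean n x)) (u j n) v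
        + \<nu>max * L2_inner \<Omega> (grad \<Omega> (u j (n + 1))) (grad \<Omega> v)
        + (\<nu> j - \<nu>max) * L2_inner \<Omega> (grad \<Omega> (u j n)) (grad \<Omega> v)
        = L2_inner \<Omega> (f j (real (n + 1) * dt)) v"
    and \<epsilon>: "0 \<le> \<epsilon>" "\<epsilon> \<le> 1" "Max ((\<lambda>j. \<bar>\<nu> j - \<nu>max\<bar> / \<nu>max) ` {1..J}) = 1 - \<epsilon>"
    and N: "N \<ge> 1"
    and stability: "\<And>j n. j \<in> {1..J} \<Longrightarrow> n < N \<Longrightarrow>
        C\<^sup>2 * dt / \<nu>max * sqrt (matrix_norm2 (pod_stiffness \<Omega> \<phi>)) *
          (L2_norm \<Omega> (grad \<Omega> (flt (\<lambda>x. u j n x - mean n x))))\<^sup>2 \<le> \<epsilon>"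
  shows "\<forall>j\<in>{1..J}.
     ereal (1/2 * (L2_norm \<Omega> (u j N))\<^sup>2 + \<nu>max * dt / 2 * (L2_norm \<Omega> (grad \<Omega> (u j N)))\<^sup>2
            + \<epsilon> * \<nu>max * dt / 4 * (\<Sum>n<N. (L2_norm \<Omega> (grad \<Omega> (u j (n + 1))))\<^sup>2))
     \<le> (\<Sum>n<N. ereal (dt / (\<nu>max * \<epsilon>)) * (dual_norm \<Omega> (f j (real (n + 1) * dt)))\<^sup>2)
       + ereal (1/2 * (L2_norm \<Omega> (u j 0))\<^sup>2 + \<nu>max * dt / 2 * (L2_norm \<Omega> (grad \<Omega> (u j 0)))\<^sup>2)"
proof
  fix j assume j: "j \<in> {1..J}"
  have \<Omega>: "open \<Omega>" using domain by (simp add: regular_domain_def)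
  have orth: "L2_orthonormal \<Omega> \<phi>" using pod by (simp add: pod_basis_def)
  have XR_vel: "XR \<subseteq> velocity_space \<Omega>"
    using pod(2) fe by (auto simp: discretely_div_free_def conforming_fe_pair_def)
  have XR_range: "XR = range (pod_elem \<phi>)" using XR pod_space_eq[OF orth] by simp
  \<comment> \<open>The increment is to be the last argument of b*; it must lie in the POD space for
    the inverse estimate and in the velocity space for the bound on b*.\<close>
  have XR_diff: "(\<lambda>x. v x - w x) \<in> XR" if "v \<in> XR" "w \<in> XR" for v w
    using that unfolding XR_range by (auto simp flip: pod_elem_diff)
  have "\<phi> i \<in> XR" for i
  proof -
    have "\<phi> i = pod_elem \<phi> (axis i 1)"
      by (simp add: fun_eq_iff pod_elem_def axis_def if_distrib[of "\<lambda>c. c *\<^sub>R _"] cong: if_cong)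
    then show ?thesis unfolding XR_range by simp
  qed
  then have \<phi>: "\<phi> i \<in> H1_vec \<Omega>" for i using XR_vel velocity_space_H1_vec by blast
  have H: "v \<in> H1_vec \<Omega>" if "v \<in> XR" for v using that XR_vel velocity_space_H1_vec by blast
  have fin: "finite {1..J}" "{1..J} \<noteq> {}" using params by auto
  have "\<nu>max \<in> \<nu> ` {1..J}" unfolding \<nu>max using fin by (intro Max_in) auto
  then have \<nu>max_pos: "\<nu>max > 0" using \<nu>_pos by auto
  have \<nu>le: "\<nu> i \<le> \<nu>max" if "i \<in> {1..J}" for i unfolding \<nu>max using that by (intro Max_ge) auto
  \<comment> \<open>The maximum is attained at some i, and 0 < \<nu> i \<le> \<nu>max gives |\<nu> i
    - \<nu>max| < \<nu>max.\<close>
  have \<epsilon>_pos: "\<epsilon> > 0"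
  proof -
    have "1 - \<epsilon> \<in> (\<lambda>j. \<bar>\<nu> j - \<nu>max\<bar> / \<nu>max) ` {1..J}"
      unfolding \<epsilon>(3)[symmetric] using fin by (intro Max_in) auto
    then obtain i where i: "i \<in> {1..J}" "1 - \<epsilon> = \<bar>\<nu> i - \<nu>max\<bar> / \<nu>max" by auto
    have "\<bar>\<nu> i - \<nu>max\<bar> < \<nu>max" using \<nu>le[OF i(1)] \<nu>_pos[OF i(1)] by simp
    then have "\<bar>\<nu> i - \<nu>max\<bar> / \<nu>max < 1" using \<nu>max_pos by simp
    with i show ?thesis by simp
  qed
  have \<nu>j: "\<bar>\<nu> j - \<nu>max\<bar> \<le> (1 - \<epsilon>) * \<nu>max"
  proof -
    have "\<bar>\<nu> j - \<nu>max\<bar> / \<nu>max \<le> 1 - \<epsilon>" unfolding \<epsilon>(3)[symmetric] using j by (intro Max_ge) auto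
    then show ?thesis using \<nu>max_pos by (simp add: field_simps)
  qed
  define E where "E n = 1/2 * (L2_norm \<Omega> (u j n))\<^sup>2 + \<nu>max * dt / 2 * (L2_norm \<Omega> (grad \<Omega> (u j n)))\<^sup>2" for n
  \<comment> \<open>Half of the \<epsilon>-dissipation left by \<open>energy_step_inequality\<close>
    is moved into \<open>X\<close>, to be set against the work of the force; the other half stays on
    the left.\<close>
  define X where "X n = dt * L2_inner \<Omega> (f j (real (n + 1) * dt)) (u j (n + 1))
      - \<epsilon> * \<nu>max * dt / 4 * (L2_norm \<Omega> (grad \<Omega> (u j (n + 1))))\<^sup>2" for n
  have step: "E (n + 1) + \<epsilon> * \<nu>max * dt / 4 * (L2_norm \<Omega> (grad \<Omega> (u j (n + 1))))\<^sup>2 \<le> E n + X n" if n: "n < N" for n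
  proof -
    let ?u = "u j n" and ?u' = "u j (n + 1)"
    let ?w = "flt (\<lambda>x. u j n x - mean n x)"
    have u: "?u \<in> XR" "?u' \<in> XR" using u_in[OF j] by auto
    have uL: "?u \<in> L2 \<Omega>" "?u' \<in> L2 \<Omega>" using u H H1_vec_L2 by auto
    have mL: "mean n \<in> L2 \<Omega>"
      unfolding mean ensemble_mean_def[abs_def] using u_in H H1_vec_L2 by (intro L2_scaleR L2_sum) blast
    \<comment> \<open>The bound on b* concerns convecting fields in the velocity space, so the
      filter must be known to return an element of the POD space.\<close>
    have w: "?w \<in> XR"
      unfolding flt XR by (rule rom_filter_in_pod_space[OF \<Omega> \<phi> orth L2_diff[OF uL(1) mL]])
    \<comment> \<open>\<open>bstar_constant\<close> bounds b* from above only. Taking the increment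
      as old minus new produces the sign -b*, the one that needs an upper bound.\<close>
    have d: "(\<lambda>x. ?u x - ?u' x) \<in> XR" by (rule XR_diff[OF u])
    define D GD where "D = L2_norm \<Omega> (\<lambda>x. ?u x - ?u' x)" and "GD = L2_norm \<Omega> (grad \<Omega> (\<lambda>x. ?u x - ?u' x))"
    have bd: "bstar \<Omega> ?w ?u (\<lambda>x. ?u x - ?u' x) = - bstar \<Omega> ?w ?u ?u'"
    proof -
      \<comment> \<open>With equal second and third arguments the two halves of b* are the same
        integral and cancel.\<close>
      have "bstar \<Omega> ?w ?u ?u = 0" by (simp add: bstar_def)
      then show ?thesis
        using bstar_diff_right[OF dim \<Omega>, of ?w ?u ?u ?u'] w u d XR_vel by auto
    qed
    have b0: "bstar \<Omega> (flt (mean n)) ?u' ?u' = 0" by (simp add: bstar_def)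
    have D2: "D\<^sup>2 = (L2_norm \<Omega> ?u')\<^sup>2 - 2 * L2_inner \<Omega> ?u ?u' + (L2_norm \<Omega> ?u)\<^sup>2"
      unfolding D_def L2_norm_square
      using L2_inner_diff_left[OF uL(1) uL(2) L2_diff[OF uL]] 
        L2_inner_diff_left[OF uL(1) uL(2) uL(1)] L2_inner_diff_left[OF uL(1) uL(2) uL(2)]
        L2_inner_commute[of \<Omega> ?u "\<lambda>x. ?u x - ?u' x"] L2_inner_commute[of \<Omega> ?u' "\<lambda>x. ?u x - ?u' x"] L2_inner_commute[of \<Omega> ?u ?u']
      by simp
    have "E (n + 1) + \<epsilon> * \<nu>max * dt / 2 * (L2_norm \<Omega> (grad \<Omega> ?u'))\<^sup>2 \<le> E n + dt * L2_inner \<Omega> (f j (real (n + 1) * dt)) ?u'"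
      unfolding E_def
    proof (rule energy_step_inequality[where C=C and D=D and GD=GD and W="L2_norm \<Omega> (grad \<Omega> ?w)"
          and S="matrix_norm2 (pod_stiffness \<Omega> \<phi>)" and p="L2_inner \<Omega> ?u ?u'" and \<nu>j="\<nu> j"
          and b="bstar \<Omega> ?w ?u ?u'" and q="L2_inner \<Omega> (grad \<Omega> ?u) (grad \<Omega> ?u')"])
      show "\<nu>max > 0" "dt > 0" "C > 0" using \<nu>max_pos params C by (auto simp: bstar_constant_def)
      show "0 \<le> D" "0 \<le> L2_norm \<Omega> (grad \<Omega> ?u)" "0 \<le> GD" "0 \<le> L2_norm \<Omega> (grad \<Omega> ?w)"
        by (simp_all add: D_def GD_def L2_norm_nonneg)
      show "0 \<le> matrix_norm2 (pod_stiffness \<Omega> \<phi>)" by (rule matrix_norm2_nonneg)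
      show "D\<^sup>2 = (L2_norm \<Omega> ?u')\<^sup>2 - 2 * L2_inner \<Omega> ?u ?u' + (L2_norm \<Omega> ?u)\<^sup>2" by (rule D2)
      show "\<bar>L2_inner \<Omega> (grad \<Omega> ?u) (grad \<Omega> ?u')\<bar> \<le> ((L2_norm \<Omega> (grad \<Omega> ?u))\<^sup>2 + (L2_norm \<Omega> (grad \<Omega> ?u'))\<^sup>2) / 2"
        using u H by (intro L2_inner_young grad_L2) auto
      show "- bstar \<Omega> ?w ?u ?u' \<le> C * L2_norm \<Omega> (grad \<Omega> ?w) * L2_norm \<Omega> (grad \<Omega> ?u) * sqrt (D * GD)"
        unfolding bd[symmetric] D_def GD_def using C w u d XR_vel unfolding bstar_constant_def by blast
      show "GD \<le> sqrt (matrix_norm2 (pod_stiffness \<Omega> \<phi>)) * D"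
        unfolding D_def GD_def using pod_inverse_estimate[OF \<Omega> \<phi> orth] d XR by blast
      show "C\<^sup>2 * dt / \<nu>max * sqrt (matrix_norm2 (pod_stiffness \<Omega> \<phi>)) * (L2_norm \<Omega> (grad \<Omega> ?w))\<^sup>2 \<le> \<epsilon>"
        by (rule stability[OF j n])
      show "\<bar>\<nu> j - \<nu>max\<bar> \<le> (1 - \<epsilon>) * \<nu>max" by (rule \<nu>j)
      show "1 / dt * ((L2_norm \<Omega> ?u')\<^sup>2 - L2_inner \<Omega> ?u ?u') + bstar \<Omega> ?w ?u ?u'
          + \<nu>max * (L2_norm \<Omega> (grad \<Omega> ?u'))\<^sup>2 + (\<nu> j - \<nu>max) * L2_inner \<Omega> (grad \<Omega> ?u) (grad \<Omega> ?u')
          = L2_inner \<Omega> (f j (real (n + 1) * dt)) ?u'"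
        using scheme[OF j u(2), of n] b0 
        unfolding L2_inner_scaleR_left L2_inner_diff_left[OF uL(2) uL(1) uL(2)] L2_norm_square by linarith
    qed
    then show ?thesis unfolding X_def by linarith
  qed
  \<comment> \<open>The induction is restricted to m \<le> N because the time step condition is
    assumed for n < N.\<close>
  have sum: "E m + \<epsilon> * \<nu>max * dt / 4 * (\<Sum>n<m. (L2_norm \<Omega> (grad \<Omega> (u j (n + 1))))\<^sup>2) \<le> (\<Sum>n<m. X n) + E 0" if "m \<le> N" for m
    using that
  proof (induction m)
    case (Suc m)
    then show ?case using step[of m] by (simp add: distrib_left)
  qed simp
  \<comment> \<open>The telescoped estimate is real; extended reals enter only when each
    \<open>X n\<close> is bounded by a dual norm.\<close>
  have "ereal (E N + \<epsilon> * \<nu>max * dt / 4 * (\<Sum>n<N. (L2_norm \<Omega> (grad \<Omega> (u j (n + 1))))\<^sup>2)) \<le> ereal ((\<Sum>n<N. X n) + E 0)"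
    using sum[of N] by simp
  also have "\<dots> = (\<Sum>n<N. ereal (X n)) + ereal (E 0)" by simp
  also have "\<dots> \<le> (\<Sum>n<N. ereal (dt / (\<nu>max * \<epsilon>)) * (dual_norm \<Omega> (f j (real (n + 1) * dt)))\<^sup>2) + ereal (E 0)"
    unfolding X_def using u_in[OF j] XR_vel \<nu>max_pos params \<epsilon>_pos
    by (intro add_right_mono sum_mono dual_norm_young) auto
  finally show "ereal (1/2 * (L2_norm \<Omega> (u j N))\<^sup>2 + \<nu>max * dt / 2 * (L2_norm \<Omega> (grad \<Omega> (u j N)))\<^sup>2
            + \<epsilon> * \<nu>max * dt / 4 * (\<Sum>n<N. (L2_norm \<Omega> (grad \<Omega> (u j (n + 1))))\<^sup>2))
     \<le> (\<Sum>n<N. ereal (dt / (\<nu>max * \<epsilon>)) * (dual_norm \<Omega> (f j (real (n + 1) * dt)))\<^sup>2)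
       + ereal (1/2 * (L2_norm \<Omega> (u j 0))\<^sup>2 + \<nu>max * dt / 2 * (L2_norm \<Omega> (grad \<Omega> (u j 0)))\<^sup>2)"
    unfolding E_def .
qed

end
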